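(* Let $\boldsymbol M=(M_1,\dots,M_k)$ be a flag matroid on $[n]$ and let $w:\mathcal B(M_1)\times\cdots\times\mathcal B(M_k)\to\mathbb R$ be a weight on its base configuration such that the coherent subdivision $\Delta_w$ is flag matroidal. Let $\mu_i:\mathcal B(M_i)\to\mathbb R$ ($1\le i\le k$) be any weights such that $\Delta_w=\Delta_{\sum_{i=1}^k\mu_i}$, where $(\sum_i\mu_i)(B_1,\dots,B_k)=\sum_i\mu_i(B_i)$. Then each $\mu_i$ (extended by $\infty$ to $\binom{[n]}{\operatorname{rk}M_i}$) is a valuated matroid, and $\overline{\operatorname{trop}}(\mu_1)\subseteq\cdots\subseteq\overline{\operatorname{trop}}(\mu_k)$.
   Context: $\mathbb T=\mathbb R\cup\{\infty\}$; $\mathbf e_B=\sum_{i\in B}\mathbf e_i$. A flag matroid is a sequence $(N_1,\dots,N_k)$ of matroids on $[n]$ such that for all $i<j$ every circuit of $N_j$ is a union of circuits of $N_i$. For a weight $w$ on $\mathcal B(M_1)\times\cdots\times\mathcal B(M_k)$ and $u\in\mathbb R^n$, let $\Delta_w^u$ be the set of tuples $(B_1,\dots,B_k)$ minimizing $w(B_1,\dots,B_k)+\langle u,\sum_i\mathbf e_{B_i}\rangle$; the coherent subdivision $\Delta_w$ is the collection $\{\Delta_w^u:u\in\mathbb R^n\}$. It is flag matroidal if every $\Delta_w^u$ equals $\mathcal B(N_1)\times\cdots\times\mathcal B(N_k)$ for some flag matroid $(N_1,\dots,N_k)$. A valuated matroid of rank $r$ on a finite set $E$ is $\mu:\binom{E}{r}\to\mathbb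 T$ such that $\mathcal B(M)=\{I:\mu(I)\ne\infty\}$ is the set of bases of a matroid $M$ and for all $B,B'\in\mathcal B(M)$, $i\in B\setminus B'$ there is $j\in B'\setminus B$ with $\mu(B)+\mu(B')\ge\mu(B\setminus i\cup j)+\mu(B'\setminus j\cup i)$. For $S\subseteq E$ let $\mathcal B_S$ be the bases $B$ with $|B\cap S|$ maximal; the contraction $\mu/_S$ (ground set $E\setminus S$, finite exactly on bases of $M/_S$) and restriction $\mu|_S$ are the valuated matroids, unique up to additive constants, with $\mu(B)=\mu|_S(B\cap S)+\mu/_S(B\setminus S)$ for $B\in\mathcal B_S$. Valuated circuits: vectors $\mathbf C_\mu(S)$, $S\in\binom{E}{r+1}$, with coordinates $\mu(S\setminus i)$ for $i\in S$ and $\infty$ otherwise, excluding all-$\infty$. $\operatorname{trop}(\mu)\subseteq\mathbb R^E/\mathbb R\mathbf 1$ is the set of $\bar u$ such that for every valuated circuit $\mathbf C$ the minimum of $\{C_i+u_i:C_i\neq\infty\}$ is attained at least twice. $\mathbb P(\mathbb T^{[n]})$ is $\mathbb T^{[n]}$ minus the all-$\infty$ vector, modulo adding real multiples of $\mathbf 1$; the projective tropical linear space is $\overline{\operatorname{trop}}(\mu)=\bigcup_{\emptyset\subseteq S\subsetneq[n]}\operatorname{trop}(\mu/_S)\times\{\infty\}^S\subseteq\mathbb P(\mathbb T^{[n]})$. *)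

theory Defs
  imports Complex_Main "HOL-Library.FuncSet" "HOL-Library.Indicator_Function" "HOL-Library.Extended_Real"
begin

text \<open>
  A matroid on the finite ground set \<open>E\<close> is represented by its collection of bases.
\<close>

definition matroid_on :: "'a set \<Rightarrow> 'a set set \<Rightarrow> bool" where
  "matroid_on E \<B> \<longleftrightarrow> finite E \<and> \<B> \<subseteq> Pow E \<and> \<B> \<noteq> {} \<and>
     (\<forall>A\<in>\<B>. \<forall>B\<in>\<B>. \<forall>i\<in>A - B. \<exists>j\<in>B - A. insert j (A - {i}) \<in> \<B>)"

definition matroid_indep :: "'a set set \<Rightarrow> 'a set \<Rightarrow> bool" where
  "matroid_indep \<B> I \<longleftrightarrow> (\<exists>B\<in>\<B>. I \<subseteq> B)"

definition matroid_circuits :: "'a set \<Rightarrow> 'a set set \<Rightarrow> 'a set set" where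
  "matroid_circuits E \<B> =
     {C. C \<subseteq> E \<and> \<not> matroid_indep \<B> C \<and> (\<forall>D. D \<subset> C \<longrightarrow> matroid_indep \<B> D)}"

definition matroid_rank :: "'a set set \<Rightarrow> nat" where
  "matroid_rank \<B> = Max (card ` \<B>)"

definition max_bases :: "'a set set \<Rightarrow> 'a set \<Rightarrow> 'a set set" where
  "max_bases \<B> S = {B \<in> \<B>. \<forall>B'\<in>\<B>. card (B' \<inter> S) \<le> card (B \<inter> S)}"

definition matroid_restriction :: "'a set set \<Rightarrow> 'a set \<Rightarrow> 'a set set" where
  "matroid_restriction \<B> S = (\<lambda>B. B \<inter> S) ` max_bases \<B> S"

definition matroid_contraction :: "'a set set \<Rightarrow> 'a set \<Rightarrow> 'a set set" where
  "matroid_contraction \<B> S = (\<lambda>B. B - S) ` max_bases \<B> S"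

definition flag_matroid :: "'a set \<Rightarrow> nat \<Rightarrow> (nat \<Rightarrow> 'a set set) \<Rightarrow> bool" where
  "flag_matroid E k N \<longleftrightarrow> (\<forall>i\<in>{1..k}. matroid_on E (N i)) \<and>
     (\<forall>i\<in>{1..k}. \<forall>j\<in>{1..k}. i < j \<longrightarrow>
        (\<forall>C\<in>matroid_circuits E (N j). \<exists>\<D>. \<D> \<subseteq> matroid_circuits E (N i) \<and> C = \<Union>\<D>))"

text \<open>
  Tuples \<open>(B\<^sub>1, \<dots>, B\<^sub>k)\<close> are extensional functions on \<open>{1..k}\<close>.  Of a weight only its values on
  the base configuration matter, and of \<open>u\<close> only its values on \<open>E\<close>.
\<close>

definition base_configuration :: "nat \<Rightarrow> (nat \<Rightarrow> 'a set set) \<Rightarrow> (nat \<Rightarrow> 'a set) set" where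
  "base_configuration k M = (\<Pi>\<^sub>E i\<in>{1..k}. M i)"

definition tilted_weight ::
  "'a set \<Rightarrow> nat \<Rightarrow> ((nat \<Rightarrow> 'a set) \<Rightarrow> real) \<Rightarrow> ('a \<Rightarrow> real) \<Rightarrow> (nat \<Rightarrow> 'a set) \<Rightarrow> real" where
  "tilted_weight E k w u B = w B + (\<Sum>x\<in>E. u x * (\<Sum>i\<in>{1..k}. indicator (B i) x))"

definition subdivision_cell ::
  "'a set \<Rightarrow> nat \<Rightarrow> (nat \<Rightarrow> 'a set set) \<Rightarrow> ((nat \<Rightarrow> 'a set) \<Rightarrow> real) \<Rightarrow> ('a \<Rightarrow> real) \<Rightarrow> (nat \<Rightarrow> 'a set) set" where
  "subdivision_cell E k M w u =
     {B \<in> base_configuration k M.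
        \<forall>B'\<in>base_configuration k M. tilted_weight E k w u B \<le> tilted_weight E k w u B'}"

definition coherent_subdivision ::
  "'a set \<Rightarrow> nat \<Rightarrow> (nat \<Rightarrow> 'a set set) \<Rightarrow> ((nat \<Rightarrow> 'a set) \<Rightarrow> real) \<Rightarrow> (nat \<Rightarrow> 'a set) set set" where
  "coherent_subdivision E k M w = {subdivision_cell E k M w u | u. True}"

definition flag_matroidal :: "'a set \<Rightarrow> nat \<Rightarrow> (nat \<Rightarrow> 'a set) set set \<Rightarrow> bool" where
  "flag_matroidal E k \<Delta> \<longleftrightarrow>
     (\<forall>D\<in>\<Delta>. \<exists>N. flag_matroid E k N \<and> D = base_configuration k N)"

text \<open>
  The tropical numbers are the extended reals other than \<open>-\<infinity>\<close>.  In the definitions below \<open>\<mu>\<close>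
  matters only on the \<open>r\<close>-element subsets of \<open>E\<close>.
\<close>

definition subsets_of_card :: "'a set \<Rightarrow> nat \<Rightarrow> 'a set set" where
  "subsets_of_card E r = {I. I \<subseteq> E \<and> card I = r}"

definition vbases :: "'a set \<Rightarrow> nat \<Rightarrow> ('a set \<Rightarrow> ereal) \<Rightarrow> 'a set set" where
  "vbases E r \<mu> = {I \<in> subsets_of_card E r. \<mu> I \<noteq> \<infinity>}"

definition valuated_matroid :: "'a set \<Rightarrow> nat \<Rightarrow> ('a set \<Rightarrow> ereal) \<Rightarrow> bool" where
  "valuated_matroid E r \<mu> \<longleftrightarrow>
     (\<forall>I\<in>subsets_of_card E r. \<mu> I \<noteq> -\<infinity>) \<and>
     matroid_on E (vbases E r \<mu>) \<and>
     (\<forall>B\<in>vbases E r \<mu>. \<forall>B'\<in>vbases E r \<mu>. \<forall>i\<in>B - B'. \<exists>j\<in>B' - B.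
        \<mu> B + \<mu> B' \<ge> \<mu> (insert j (B - {i})) + \<mu> (insert i (B' - {j})))"

definition extend_by_infinity :: "'a set set \<Rightarrow> ('a set \<Rightarrow> real) \<Rightarrow> 'a set \<Rightarrow> ereal" where
  "extend_by_infinity \<B> \<mu> I = (if I \<in> \<B> then ereal (\<mu> I) else \<infinity>)"

text \<open>
  \<open>\<rho>\<close> is a restriction and \<open>\<nu>\<close> a contraction of \<open>\<mu>\<close>; both are determined only up to (opposite)
  additive constants, and tropical linear spaces do not depend on the choice.
\<close>

definition restriction_contraction_pair ::
  "'a set \<Rightarrow> nat \<Rightarrow> ('a set \<Rightarrow> ereal) \<Rightarrow> 'a set \<Rightarrow> ('a set \<Rightarrow> ereal) \<Rightarrow> ('a set \<Rightarrow> ereal) \<Rightarrow> bool" where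
  "restriction_contraction_pair E r \<mu> S \<rho> \<nu> \<longleftrightarrow>
     (let \<B> = vbases E r \<mu>;
          \<R> = matroid_restriction \<B> S;
          \<C> = matroid_contraction \<B> S
      in valuated_matroid S (matroid_rank \<R>) \<rho> \<and> vbases S (matroid_rank \<R>) \<rho> = \<R> \<and>
         valuated_matroid (E - S) (matroid_rank \<C>) \<nu> \<and> vbases (E - S) (matroid_rank \<C>) \<nu> = \<C> \<and>
         (\<forall>B\<in>max_bases \<B> S. \<mu> B = \<rho> (B \<inter> S) + \<nu> (B - S)))"

definition valuated_contraction ::
  "'a set \<Rightarrow> nat \<Rightarrow> ('a set \<Rightarrow> ereal) \<Rightarrow> 'a set \<Rightarrow> ('a set \<Rightarrow> ereal)" where
  "valuated_contraction E r \<mu> S = (SOME \<nu>. \<exists>\<rho>. restriction_contraction_pair E r \<mu> S \<rho> \<nu>)"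

definition contraction_rank :: "'a set \<Rightarrow> nat \<Rightarrow> ('a set \<Rightarrow> ereal) \<Rightarrow> 'a set \<Rightarrow> nat" where
  "contraction_rank E r \<mu> S = matroid_rank (matroid_contraction (vbases E r \<mu>) S)"

definition circuit_vector :: "('a set \<Rightarrow> ereal) \<Rightarrow> 'a set \<Rightarrow> 'a \<Rightarrow> ereal" where
  "circuit_vector \<mu> S = (\<lambda>i. if i \<in> S then \<mu> (S - {i}) else \<infinity>)"

definition valuated_circuits :: "'a set \<Rightarrow> nat \<Rightarrow> ('a set \<Rightarrow> ereal) \<Rightarrow> ('a \<Rightarrow> ereal) set" where
  "valuated_circuits E r \<mu> = circuit_vector \<mu> ` subsets_of_card E (r + 1) - {\<lambda>_. \<infinity>}"

definition min_attained_twice :: "'a set \<Rightarrow> ('a \<Rightarrow> ereal) \<Rightarrow> ('a \<Rightarrow> real) \<Rightarrow> bool" where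
  "min_attained_twice E C u \<longleftrightarrow>
     (\<exists>i\<in>E. \<exists>j\<in>E. i \<noteq> j \<and> C i \<noteq> \<infinity> \<and> C j \<noteq> \<infinity> \<and>
        (\<forall>l\<in>E. C l \<noteq> \<infinity> \<longrightarrow>
           C i + ereal (u i) \<le> C l + ereal (u l) \<and> C j + ereal (u j) \<le> C l + ereal (u l)))"

text \<open>The equivalence relations whose quotients are \<open>\<real>\<^sup>E/\<real>\<one>\<close> and \<open>\<P>(\<T>\<^sup>E)\<close>.\<close>

definition torus_rel :: "'a set \<Rightarrow> (('a \<Rightarrow> real) \<times> ('a \<Rightarrow> real)) set" where
  "torus_rel E = {(u, v). u \<in> E \<rightarrow>\<^sub>E UNIV \<and> v \<in> E \<rightarrow>\<^sub>E UNIV \<and> (\<exists>c. \<forall>i\<in>E. v i = u i + c)}"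

definition trop_vectors :: "'a set \<Rightarrow> ('a \<Rightarrow> ereal) set" where
  "trop_vectors E = (E \<rightarrow>\<^sub>E {x. x \<noteq> -\<infinity>}) - {\<lambda>i\<in>E. \<infinity>}"

definition trop_proj_rel :: "'a set \<Rightarrow> (('a \<Rightarrow> ereal) \<times> ('a \<Rightarrow> ereal)) set" where
  "trop_proj_rel E = {(x, y). x \<in> trop_vectors E \<and> y \<in> trop_vectors E \<and>
     (\<exists>c::real. \<forall>i\<in>E. y i = x i + ereal c)}"

definition trop_proj_space :: "'a set \<Rightarrow> ('a \<Rightarrow> ereal) set set" where
  "trop_proj_space E = trop_vectors E // trop_proj_rel E"

definition trop :: "'a set \<Rightarrow> nat \<Rightarrow> ('a set \<Rightarrow> ereal) \<Rightarrow> ('a \<Rightarrow> real) set set" where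
  "trop E r \<mu> = {torus_rel E `` {u} | u. u \<in> E \<rightarrow>\<^sub>E UNIV \<and>
     (\<forall>C\<in>valuated_circuits E r \<mu>. min_attained_twice E C u)}"

definition infinity_on :: "'a set \<Rightarrow> 'a set \<Rightarrow> ('a \<Rightarrow> real) \<Rightarrow> 'a \<Rightarrow> ereal" where
  "infinity_on E S u = (\<lambda>i\<in>E. if i \<in> S then \<infinity> else ereal (u i))"

definition times_infinity :: "'a set \<Rightarrow> 'a set \<Rightarrow> ('a \<Rightarrow> real) set set \<Rightarrow> ('a \<Rightarrow> ereal) set set" where
  "times_infinity E S X =
     {trop_proj_rel E `` {infinity_on E S u} | u. u \<in> E - S \<rightarrow>\<^sub>E UNIV \<and> torus_rel (E - S) `` {u} \<in> X}"

definition proj_trop :: "'a set \<Rightarrow> nat \<Rightarrow> ('a set \<Rightarrow> ereal) \<Rightarrow> ('a \<Rightarrow> ereal) set set" where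
  "proj_trop E r \<mu> =
     (\<Union>S\<in>{S. S \<subset> E}.
        times_infinity E S (trop (E - S) (contraction_rank E r \<mu> S) (valuated_contraction E r \<mu> S)))"

lemma infinity_on_in_trop_vectors:
  assumes "S \<subset> E"
  shows "infinity_on E S u \<in> trop_vectors E"
proof -
  obtain i where "i \<in> E" "i \<notin> S" using assms by auto
  then have "infinity_on E S u i \<noteq> (\<lambda>i\<in>E. \<infinity>) i" by (simp add: infinity_on_def)
  then have "infinity_on E S u \<noteq> (\<lambda>i\<in>E. \<infinity>)" by metis
  then show ?thesis by (auto simp: trop_vectors_def infinity_on_def)
qed

lemma proj_trop_subset: "proj_trop E r \<mu> \<subseteq> trop_proj_space E"
  unfolding proj_trop_def times_infinity_def trop_proj_space_def
  by (auto intro!: quotientI infinity_on_in_trop_vectors)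

end

theory Submission
  imports Defs
begin

text \<open>
  A cell of a subdivision induced by a sum \<open>\<Sum>\<^sub>i \<mu>\<^sub>i\<close> is the product of the cells of the \<open>\<mu>\<^sub>i\<close>, so for
  each \<open>u\<close> these cells form a flag matroid.  If the exchange property failed for two bases at
  distance two, some tilt \<open>u\<close> would make them the only minimizers, and two bases at distance two do
  not form a matroid; local exchange then implies exchange for all pairs.
  A point \<open>u\<close> lies in the tropical linear space of \<open>\<nu>\<close> iff every element occurs in a minimizer of
  \<open>\<nu>(B) - u(B)\<close>, i.e. iff this cell has no loops.  Contraction by \<open>S\<close> amounts to tilting by a large
  negative constant on \<open>S\<close>.  The inclusion of the tropical linear spaces follows because a loop of
  a constituent of a flag matroid, being a circuit, is a loop of every earlier constituent.
\<close>

section \<open>Cells of a single weight, exchange for real weights, and cardinalities of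
  bases\<close>

definition min_bases :: "'a set set \<Rightarrow> ('a set \<Rightarrow> real) \<Rightarrow> ('a \<Rightarrow> real) \<Rightarrow> 'a set set" where
  "min_bases \<B> f u = {A \<in> \<B>. \<forall>A'\<in>\<B>. f A + sum u A \<le> f A' + sum u A'}"

text \<open>Membership of both new sets in \<open>\<B>\<close> replaces the finiteness of their
  \<open>ereal\<close> values. The element \<open>i\<close> is a parameter so that it can stay fixed
  while the second basis varies.\<close>

definition exchangeable :: "'a set set \<Rightarrow> ('a set \<Rightarrow> real) \<Rightarrow> 'a set \<Rightarrow> 'a set \<Rightarrow> 'a \<Rightarrow> bool" where
  "exchangeable \<B> f A B i \<longleftrightarrow>
     (\<exists>j\<in>B - A. insert j (A - {i}) \<in> \<B> \<and> insert i (B - {j}) \<in> \<B> \<and>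
        f (insert j (A - {i})) + f (insert i (B - {j})) \<le> f A + f B)"

definition valuated_exchange :: "'a set set \<Rightarrow> ('a set \<Rightarrow> real) \<Rightarrow> bool" where
  "valuated_exchange \<B> f \<longleftrightarrow> (\<forall>A\<in>\<B>. \<forall>B\<in>\<B>. \<forall>i\<in>A - B. exchangeable \<B> f A B i)"

lemma matroid_on_finite:
  assumes "matroid_on E \<B>"
  shows "finite \<B>" "A \<in> \<B> \<Longrightarrow> finite A"
  using assms unfolding matroid_on_def
  by (auto intro: finite_subset[of _ "Pow E"] finite_subset[of A E])

lemma finite_ex_min:
  fixes g :: "'a \<Rightarrow> real"
  assumes "finite X" "X \<noteq> {}"
  obtains x where "x \<in> X" "\<And>y. y \<in> X \<Longrightarrow> g x \<le> g y"
  using ex_is_arg_min_if_finite[OF assms, of g] by (auto simp: is_arg_min_linorder)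

lemma matroid_exchange:
  assumes "matroid_on E \<B>" "A \<in> \<B>" "B \<in> \<B>" "i \<in> A - B"
  obtains j where "j \<in> B - A" "insert j (A - {i}) \<in> \<B>"
  using assms unfolding matroid_on_def by meson

lemma card_exchange:
  assumes "finite A" "i \<in> A" "j \<notin> A"
  shows "card (insert j (A - {i})) = card A"
  using assms by (metis Diff_iff card.insert card.remove finite_Diff)

text \<open>Exchanging an element of \<open>A - B\<close> for one of \<open>B - A\<close> preserves
  the size of \<open>A\<close> and shrinks \<open>A - B\<close>; the process ends inside
  \<open>B\<close>.\<close>

lemma matroid_card_le:
  assumes "matroid_on E \<B>" "A \<in> \<B>" "B \<in> \<B>"
  shows "card A \<le> card B"
  using assms(2)
proof (induction "card (A - B)" arbitrary: A rule: less_induct)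
  case less
  have fin: "finite A" "finite B"
    using matroid_on_finite(2)[OF assms(1)] less.prems assms(3) by auto
  show ?case
  proof (cases "A \<subseteq> B")
    case True
    then show ?thesis using fin card_mono by blast
  next
    case False
    then obtain i where i: "i \<in> A - B" by blast
    then obtain j where j: "j \<in> B - A" "insert j (A - {i}) \<in> \<B>"
      using matroid_exchange[OF assms(1) less.prems assms(3)] by blast
    have "insert j (A - {i}) - B \<subset> A - B" using i j by auto
    then have "card (insert j (A - {i}) - B) < card (A - B)"
      using fin by (intro psubset_card_mono) auto
    from less.hyps[OF this j(2)] show ?thesis
      using card_exchange[of A i j] i j fin by auto
  qed
qed

lemma matroid_card_eq:
  assumes "matroid_on E \<B>" "A \<in> \<B>" "B \<in> \<B>"
  shows "card A = card B"
  using matroid_card_le[OF assms] matroid_card_le[OF assms(1,3,2)] by simp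

lemma matroid_card_Diff_eq:
  assumes "matroid_on E \<B>" "A \<in> \<B>" "B \<in> \<B>"
  shows "card (A - B) = card (B - A)"
  using matroid_card_eq[OF assms] matroid_on_finite(2)[OF assms(1)] assms(2,3)
  by (metis card_Diff_subset_Int Int_commute finite_Int)

lemma matroid_rank_eq:
  assumes "matroid_on E \<B>" "A \<in> \<B>"
  shows "matroid_rank \<B> = card A"
proof -
  have "card ` \<B> = {card A}" using matroid_card_eq[OF assms(1) _ assms(2)] assms(2) by (metis (lifting) image_cong image_constant)
  then show ?thesis by (simp add: matroid_rank_def)
qed

lemma vbases_extend_by_infinity:
  assumes "matroid_on E \<B>"
  shows "vbases E (matroid_rank \<B>) (extend_by_infinity \<B> f) = \<B>"
proof -
  have "A \<subseteq> E \<and> card A = matroid_rank \<B>" if "A \<in> \<B>" for A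
    using matroid_rank_eq[OF assms that] assms that unfolding matroid_on_def by auto
  then show ?thesis
    by (auto simp: vbases_def subsets_of_card_def extend_by_infinity_def)
qed

lemma valuated_matroid_extend_by_infinity:
  assumes "matroid_on E \<B>" "valuated_exchange \<B> f"
  shows "valuated_matroid E (matroid_rank \<B>) (extend_by_infinity \<B> f)"
  unfolding valuated_matroid_def vbases_extend_by_infinity[OF assms(1)]
proof (intro conjI ballI)
  fix A B i assume "A \<in> \<B>" "B \<in> \<B>" "i \<in> A - B"
  then show "\<exists>j\<in>B - A. extend_by_infinity \<B> f (insert j (A - {i})) +
      extend_by_infinity \<B> f (insert i (B - {j}))
      \<le> extend_by_infinity \<B> f A + extend_by_infinity \<B> f B"
    using assms(2) unfolding valuated_exchange_def exchangeable_def
    by (fastforce simp: extend_by_infinity_def)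
qed (use assms in \<open>auto simp: extend_by_infinity_def\<close>)

subsection \<open>Local exchange implies exchange\<close>

text \<open>The only possible swap turns \<open>A\<close> into \<open>B\<close> and \<open>B\<close>
  into \<open>A\<close>, so the inequality is an equality.\<close>

lemma exchangeable_card_one:
  assumes m: "matroid_on E \<B>" and AB: "A \<in> \<B>" "B \<in> \<B>" and i: "i \<in> A - B"
    and c: "card (B - A) \<le> 1"
  shows "exchangeable \<B> f A B i"
proof -
  have fin: "finite A" "finite B" using matroid_on_finite(2)[OF m] AB by auto
  have e: "card (A - B) = card (B - A)" using matroid_card_Diff_eq[OF m AB] .
  have "card (A - B) \<noteq> 0" using i fin by auto
  then have "card (A - B) = 1" "card (B - A) = 1" using c e by auto
  then obtain j where "A - B = {i}" and j: "B - A = {j}"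
    using i by (metis card_1_singletonE singletonD)
  then have "insert j (A - {i}) = B" "insert i (B - {j}) = A" by blast+
  then show ?thesis unfolding exchangeable_def using j AB by (intro bexI[of _ j]) auto
qed

text \<open>Murota's descent: after tilting by a suitable \<open>p\<close>, a failing pair at distance
  at least three can be replaced by a failing pair at smaller distance.\<close>

lemma valuated_exchange_of_local:
  assumes m: "matroid_on E \<B>"
    and loc: "\<And>A B i. A \<in> \<B> \<Longrightarrow> B \<in> \<B> \<Longrightarrow> card (A - B) = 2 \<Longrightarrow> i \<in> A - B \<Longrightarrow> exchangeable \<B> f A B i"
  shows "valuated_exchange \<B> f"
proof -
  have "exchangeable \<B> f A B i" if "A \<in> \<B>" "B \<in> \<B>" "i \<in> A - B" for A B i
    using that
  proof (induction "card (B - A)" arbitrary: B rule: less_induct)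
    case less
    note A = \<open>A \<in> \<B>\<close> and B = \<open>B \<in> \<B>\<close> and i = \<open>i \<in> A - B\<close>
    have fin: "finite A" "finite B" using matroid_on_finite(2)[OF m] A B by auto
    have ceq: "card (A - B) = card (B - A)" using matroid_card_Diff_eq[OF m A B] .
    consider "card (B - A) \<le> 1" | "card (B - A) = 2" | "card (B - A) \<ge> 3" by linarith
    then show ?case
    proof cases
      case 1
      then show ?thesis using exchangeable_card_one[OF m A B i] by blast
    next
      case 2
      then show ?thesis using loc[OF A B] ceq i by simp
    next
      case 3
      show ?thesis
      proof (rule ccontr)
        assume neg: "\<not> exchangeable \<B> f A B i"
        \<comment> \<open>\<open>p\<close> acts as a price: where \<open>A - i + v\<close> is a
          basis, adding \<open>p v\<close> to its value gives exactly \<open>f A\<close>. The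
          \<open>- 1\<close> secures the strict inequality of \<open>claim1\<close> where only
          \<open>B - v + i\<close> is a basis; 0 is an arbitrary default.\<close>
        define p where "p v = (if insert v (A - {i}) \<in> \<B> then f A - f (insert v (A - {i}))
          else if insert i (B - {v}) \<in> \<B> then f (insert i (B - {v})) - f B - 1 else 0)" for v
        have claim1: "f B + p v < f (insert i (B - {v}))"
          if "v \<in> B - A" "insert i (B - {v}) \<in> \<B>" for v
          using neg that unfolding exchangeable_def p_def by force
        \<comment> \<open>Exchanging \<open>v1\<close> out of \<open>B\<close> may bring in
          \<open>i\<close> itself. Then a second swap leads to a basis at distance two from
          \<open>B\<close>, and local exchange against \<open>B\<close> yields a single swap by an
          element other than \<open>i\<close>.\<close>
        have "\<exists>u\<in>A - B. u \<noteq> i \<and> (\<exists>v\<in>B - A. insert u (B - {v}) \<in> \<B>)"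
        proof -
          obtain v1 where v1: "v1 \<in> B - A" using 3 by (metis all_not_in_conv card.empty not_numeral_le_zero)
          then obtain u1 where u1: "u1 \<in> A - B" "insert u1 (B - {v1}) \<in> \<B>"
            using matroid_exchange[OF m B A] by blast
          show ?thesis
          proof (cases "u1 = i")
            case True
            have "\<not> B - A \<subseteq> {v1}" using 3 card_mono[of "{v1}" "B - A"] by auto
            then obtain v2 where v2: "v2 \<in> B - A" "v2 \<noteq> v1" by blast
            let ?B1 = "insert i (B - {v1})"
            have "v2 \<in> ?B1 - A" using v2 by blast
            then obtain u2 where u2: "u2 \<in> A - ?B1" "insert u2 (?B1 - {v2}) \<in> \<B>"
              using matroid_exchange[OF m u1(2)[unfolded True] A] by blast
            let ?B2 = "insert u2 (?B1 - {v2})"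
            have d: "?B2 - B = {u2, i}" "B - ?B2 = {v1, v2}" "u2 \<noteq> i"
              using u2 v1 v2 i by auto
            have "exchangeable \<B> f ?B2 B u2"
              using loc[OF u2(2) B, of u2] d by simp
            then obtain v where "v \<in> {v1, v2}" "insert u2 (B - {v}) \<in> \<B>"
              unfolding exchangeable_def d(2) by blast
            then show ?thesis using u2 v1 v2 d(3) by blast
          qed (use u1 v1 in blast)
        qed
        then obtain u0 where u0: "u0 \<in> A - B" "u0 \<noteq> i" "\<exists>v\<in>B - A. insert u0 (B - {v}) \<in> \<B>"
          by blast
        \<comment> \<open>Among the swaps of \<open>u0\<close> into \<open>B\<close>, the one at
          \<open>v0\<close> is cheapest after deducting the price. The resulting basis is closer to
          \<open>A\<close> and still lacks \<open>i\<close>, so it falls under the induction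
          hypothesis.\<close>
        let ?V = "{v \<in> B - A. insert u0 (B - {v}) \<in> \<B>}"
        have "finite ?V" "?V \<noteq> {}" using fin u0(3) by auto
        then obtain v0 where v0: "v0 \<in> ?V"
          and "\<And>v. v \<in> ?V \<Longrightarrow> f (insert u0 (B - {v0})) - p v0 \<le> f (insert u0 (B - {v})) - p v"
          using finite_ex_min[of ?V "\<lambda>v. f (insert u0 (B - {v})) - p v"] by blast
        then have v0min: "f (insert u0 (B - {v0})) - p v0 \<le> f (insert u0 (B - {v})) - p v"
          if "v \<in> B - A" "insert u0 (B - {v}) \<in> \<B>" for v
          using that by blast
        let ?B' = "insert u0 (B - {v0})"
        have B': "?B' \<in> \<B>" using v0 by blast
        have "card (?B' - A) < card (B - A)"
          using u0 v0 fin by (intro psubset_card_mono) auto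
        moreover have "i \<in> A - ?B'" using i u0 by blast
        ultimately have "exchangeable \<B> f A ?B' i" using less.hyps A B' by blast
        then obtain v where v: "v \<in> ?B' - A" "insert v (A - {i}) \<in> \<B>" "insert i (?B' - {v}) \<in> \<B>"
          and le: "f (insert v (A - {i})) + f (insert i (?B' - {v})) \<le> f A + f ?B'"
          unfolding exchangeable_def by blast
        let ?Z = "insert i (?B' - {v})"
        have vB: "v \<in> B - A" "v \<noteq> v0" using v u0 by auto
        have "p v = f A - f (insert v (A - {i}))" using v(2) by (simp add: p_def)
        with le have le': "f ?Z - p v \<le> f ?B'" by linarith
        have d: "?Z - B = {u0, i}" "B - ?Z = {v0, v}" using u0 v0 vB i by auto
        have "exchangeable \<B> f ?Z B i" using loc[OF v(3) B, of i] d u0(2) by simp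
        then obtain y where y: "y \<in> {v0, v}" "insert y (?Z - {i}) \<in> \<B>" "insert i (B - {y}) \<in> \<B>"
          and yle: "f (insert y (?Z - {i})) + f (insert i (B - {y})) \<le> f ?Z + f B"
          unfolding exchangeable_def d(2) by blast
        \<comment> \<open>Either choice of \<open>y\<close> contradicts \<open>claim1\<close>: for
          \<open>y = v\<close> directly, as the first exchanged set is \<open>?B'\<close>; for
          \<open>y = v0\<close> through the minimality of \<open>v0\<close>.\<close>
        show False
        proof (cases "y = v")
          case True
          have "insert v (?Z - {i}) = ?B'" using u0 v0 vB i by auto
          then show False using yle le' claim1[of v] vB y True by simp
        next
          case False
          then have "y = v0" using y by blast
          have "insert v0 (?Z - {i}) = insert u0 (B - {v})" using u0 v0 vB i by auto
          then show False
            using yle le' claim1[of v0] v0 v0min[of v] vB y \<open>y = v0\<close> by simp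
        qed
      qed
    qed
  qed
  then show ?thesis unfolding valuated_exchange_def by blast
qed

subsection \<open>Matroidal cells imply local exchange\<close>

text \<open>Distinct values of the integral \<open>h\<close> differ by at least 1, and
  \<open>t0\<close> exceeds \<open>\<bar>g A\<bar> + \<bar>g B\<bar>\<close> for all
  \<open>A\<close>, \<open>B\<close> in the finite set \<open>X\<close>. Such penalties later
  confine minimizers to bases in a prescribed position.\<close>

lemma large_penalty:
  fixes g :: "'a \<Rightarrow> real" and h :: "'a \<Rightarrow> int"
  assumes "finite X"
  shows "\<exists>t0. \<forall>t\<ge>t0. \<forall>A\<in>X. \<forall>B\<in>X. h A < h B \<longrightarrow>
           g B - t * of_int (h B) < g A - t * of_int (h A)"
proof -
  define t0 where "t0 = (\<Sum>A\<in>X. 2 * \<bar>g A\<bar>) + 1"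
  have b: "2 * \<bar>g A\<bar> \<le> t0 - 1" if "A \<in> X" for A
    unfolding t0_def using assms that member_le_sum[of A X "\<lambda>A. 2 * \<bar>g A\<bar>"] by simp
  have "g B - t * of_int (h B) < g A - t * of_int (h A)"
    if "t \<ge> t0" "A \<in> X" "B \<in> X" "h A < h B" for A B t
  proof -
    have "1 \<le> real_of_int (h B - h A)" using that by linarith
    moreover have "t \<ge> 0" using b[OF that(2)] that(1) by simp
    ultimately have "t \<le> t * real_of_int (h B - h A)"
      by (metis mult.right_neutral mult_left_mono)
    then have "t \<le> t * of_int (h B) - t * of_int (h A)" by (simp add: algebra_simps)
    then show ?thesis using b[OF that(2)] b[OF that(3)] that(1) by linarith
  qed
  then show ?thesis by blast
qed

text \<open>For choosing a tilt parameter between two bounds, each of which counts only if the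
  corresponding set is a basis.\<close>

lemma between_if:
  fixes l h :: real
  assumes "P \<Longrightarrow> Q \<Longrightarrow> l < h"
  shows "\<exists>s. (P \<longrightarrow> l < s) \<and> (Q \<longrightarrow> s < h)"
  using assms dense[of l h] by (metis gt_ex lt_ex)

text \<open>Apart from \<open>A\<close> and \<open>B\<close>, only four sets of the right size lie
  between \<open>A \<inter> B\<close> and \<open>A \<union> B\<close>. They form two complementary
  pairs, and failure at \<open>i\<close> makes each pair consisting of bases cost more than
  \<open>A\<close> and \<open>B\<close> together. This leaves room for a tilt that makes all four
  too expensive.\<close>

lemma local_exchange_of_cells:
  assumes m: "matroid_on E \<B>" and cells: "\<And>u. matroid_on E (min_bases \<B> f u)"
    and A: "A \<in> \<B>" and B: "B \<in> \<B>" and c2: "card (A - B) = 2" and i: "i \<in> A - B"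
  shows "exchangeable \<B> f A B i"
proof (rule ccontr)
  assume neg: "\<not> exchangeable \<B> f A B i"
  have fin: "finite X" if "X \<in> \<B>" for X using matroid_on_finite(2)[OF m that] .
  define I where "I = A \<inter> B"
  have "card (A - B - {i}) = 1" using c2 i fin[OF A] by simp
  then obtain b where "A - B - {i} = {b}" by (meson card_1_singletonE)
  then have ab: "A - B = {i, b}" "i \<noteq> b" using i by auto
  have "card (B - A) = 2" using matroid_card_Diff_eq[OF m A B] c2 by simp
  then obtain c d where cd: "B - A = {c, d}" "c \<noteq> d" by (meson card_2_iff)
  have finI: "finite I" using fin[OF A] by (simp add: I_def)
  have dis: "i \<noteq> b" "i \<noteq> c" "i \<noteq> d" "b \<noteq> c" "b \<noteq> d" "c \<noteq> d"
    "i \<notin> I" "b \<notin> I" "c \<notin> I" "d \<notin> I" using ab cd by (auto simp: I_def)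
  have A_eq: "A = insert i (insert b I)" and B_eq: "B = insert c (insert d I)"
    using ab cd by (auto simp: I_def)
  define pr where "pr x y = insert x (insert y I)" for x y
  have sets: "insert c (A - {i}) = pr b c" "insert i (B - {c}) = pr i d"
     "insert d (A - {i}) = pr b d" "insert i (B - {d}) = pr i c"
    using dis by (auto simp: A_eq B_eq pr_def)
  have n1: "f A + f B < f (pr b c) + f (pr i d)" if "pr b c \<in> \<B>" "pr i d \<in> \<B>"
    using neg cd that unfolding exchangeable_def sets[symmetric] by force
  have n2: "f A + f B < f (pr b d) + f (pr i c)" if "pr b d \<in> \<B>" "pr i c \<in> \<B>"
    using neg cd that unfolding exchangeable_def sets[symmetric] by force
  \<comment> \<open>\<open>s\<close> will be \<open>v i + v c\<close> and \<open>s'\<close> will be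
    \<open>v i - v c\<close>. With \<open>A\<close> and \<open>B\<close> normalized to cost 0, the
    bounds on \<open>s\<close> make \<open>pr i c\<close> and \<open>pr b d\<close> cost more than
    0, and those on \<open>s'\<close> do so for \<open>pr i d\<close> and
    \<open>pr b c\<close>.\<close>
  obtain s where s: "pr i c \<in> \<B> \<Longrightarrow> - f (pr i c) < s" "pr b d \<in> \<B> \<Longrightarrow> s < f (pr b d) - f A - f B"
    using between_if[of "pr i c \<in> \<B>" "pr b d \<in> \<B>" "- f (pr i c)" "f (pr b d) - f A - f B"] n2
    by force
  obtain s' where s': "pr i d \<in> \<B> \<Longrightarrow> f B - f (pr i d) < s'" "pr b c \<in> \<B> \<Longrightarrow> s' < f (pr b c) - f A"
    using between_if[of "pr i d \<in> \<B>" "pr b c \<in> \<B>" "f B - f (pr i d)" "f (pr b c) - f A"] n1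
    by force
  \<comment> \<open>The tilt by \<open>v\<close> makes \<open>A\<close> and \<open>B\<close> the only minimizers among the bases
      between \<open>A \<inter> B\<close> and \<open>A \<union> B\<close>; the penalty \<open>t\<close> excludes all other bases.\<close>
  define v where "v z = (if z = i then (s + s') / 2 else if z = b then - f A - (s + s') / 2
    else if z = c then (s - s') / 2 else if z = d then - f B - (s - s') / 2 else 0)" for z
  \<comment> \<open>Among bases, \<open>h\<close> is at most \<open>card I\<close>, with equality
    exactly for those between \<open>I\<close> and \<open>A \<union> B\<close>.\<close>
  define h where "h X = int (card (X \<inter> I)) - int (card (X - (A \<union> B)))" for X
  obtain t where t: "\<And>X Y. X \<in> \<B> \<Longrightarrow> Y \<in> \<B> \<Longrightarrow> h X < h Y \<Longrightarrow>
      (f Y + sum v Y) - t * of_int (h Y) < (f X + sum v X) - t * of_int (h X)"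
    using large_penalty[OF matroid_on_finite(1)[OF m], of h "\<lambda>X. f X + sum v X"] by blast
  define u where "u z = v z - t * (of_bool (z \<in> I) - of_bool (z \<notin> A \<union> B))" for z
  have su: "sum u X = sum v X - t * of_int (h X)" if "X \<in> \<B>" for X
  proof -
    have "X \<inter> {z. z \<notin> A \<union> B} = X - (A \<union> B)" by blast
    then show ?thesis
      using fin[OF that]
      by (simp add: u_def sum_subtractf sum_distrib_left[symmetric] h_def Collect_mem_eq)
  qed
  have hA: "h A = card I" and hB: "h B = card I"
  proof -
    have "A \<inter> I = I" "B \<inter> I = I" by (auto simp: I_def)
    moreover have "card (A - (A \<union> B)) = 0" "card (B - (A \<union> B)) = 0"
      by (metis Diff_eq_empty_iff Un_upper1 card.empty, metis Diff_eq_empty_iff Un_upper2 card.empty)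
    ultimately show "h A = card I" "h B = card I" unfolding h_def by simp_all
  qed
  have vI: "sum v I = 0" using dis by (intro sum.neutral) (auto simp: v_def)
  have gpr: "sum v (pr x y) = v x + v y" if "x \<notin> I" "y \<notin> I" "x \<noteq> y" for x y
    using that finI vI by (simp add: pr_def)
  have gA: "f A + sum v A = 0" and gB: "f B + sum v B = 0"
    using gpr[of i b] gpr[of c d] dis by (auto simp: A_eq[folded pr_def] B_eq[folded pr_def] v_def)
  have strict: "f A + sum u A < f X + sum u X" if X: "X \<in> \<B>" "X \<noteq> A" "X \<noteq> B" for X
  proof (cases "h X < h A")
    case True
    then show ?thesis using t[OF X(1) A] su X(1) A by simp
  next
    case False
    have "card (X \<inter> I) \<le> card I" using finI by (intro card_mono) auto
    then have "card (X \<inter> I) = card I" "card (X - (A \<union> B)) = 0"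
      using False hA by (auto simp: h_def)
    then have IX: "I \<subseteq> X" and XU: "X \<subseteq> A \<union> B" and hX: "h X = h A"
      using fin[OF X(1)] finI card_subset_eq[of I "X \<inter> I"] hA by (auto simp: h_def)
    have "card X = card I + 2"
      using matroid_card_eq[OF m X(1) A] dis finI by (simp add: A_eq)
    then have "card (X - I) = 2" using IX finI by (simp add: card_Diff_subset)
    then obtain x y where xy: "X - I = {x, y}" "x \<noteq> y" by (meson card_2_iff)
    have "X - I \<subseteq> {i, b, c, d}" using XU by (auto simp: A_eq B_eq)
    then have xy': "x \<in> {i, b, c, d}" "y \<in> {i, b, c, d}" using xy by auto
    have X_eq: "X = pr x y" using xy IX by (auto simp: pr_def)
    have "X \<in> {pr i c, pr i d, pr b c, pr b d, pr i b, pr c d}"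
      using xy' xy(2) unfolding X_eq
      by (elim insertE emptyE) (simp_all add: pr_def insert_commute)
    moreover have "X \<noteq> pr i b" "X \<noteq> pr c d" using X by (simp_all add: pr_def A_eq B_eq)
    ultimately consider "X = pr i c" | "X = pr i d" | "X = pr b c" | "X = pr b d" by blast
    then have "0 < f X + sum v X"
      using s s' gpr[of i c] gpr[of i d] gpr[of b c] gpr[of b d] dis X(1)
      by cases (auto simp: v_def field_simps)
    then show ?thesis using su[OF X(1)] su[OF A] gA hX by simp
  qed
  have eqAB: "f A + sum u A = f B + sum u B" using su[OF A] su[OF B] gA gB hA hB by simp
  have le: "f A + sum u A \<le> f X + sum u X" if "X \<in> \<B>" for X
    using strict[OF that] eqAB by (cases "X = A \<or> X = B") auto
  have AB: "A \<in> min_bases \<B> f u" "B \<in> min_bases \<B> f u"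
    using le A B eqAB by (auto simp: min_bases_def)
  \<comment> \<open>The exchanged set has lost \<open>i\<close> but kept \<open>b\<close>, so it is
    neither \<open>A\<close> nor \<open>B\<close>, although \<open>strict\<close> leaves the cell no
    other members.\<close>
  obtain j where j: "j \<in> B - A" "insert j (A - {i}) \<in> min_bases \<B> f u"
    using matroid_exchange[OF cells AB i] .
  define X where "X = insert j (A - {i})"
  have "i \<noteq> j" "b \<in> A" "b \<notin> B" using i j(1) ab by auto
  then have "i \<notin> X" "b \<in> X" using ab(2) by (auto simp: X_def)
  then have "X \<noteq> A" "X \<noteq> B" using i \<open>b \<notin> B\<close> by auto
  moreover have "X \<in> \<B>" "f X + sum u X \<le> f A + sum u A"
    using j(2) A by (simp_all add: min_bases_def X_def)
  ultimately show False using strict[of X] by simp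
qed

lemma valuated_exchange_of_cells:
  assumes "matroid_on E \<B>" and "\<And>u. matroid_on E (min_bases \<B> f u)"
  shows "valuated_exchange \<B> f"
  using valuated_exchange_of_local[OF assms(1)] local_exchange_of_cells[OF assms] by blast

subsection \<open>Cells of a sum of weights\<close>

lemma min_bases_nonempty:
  assumes "matroid_on E \<B>"
  shows "min_bases \<B> f u \<noteq> {}"
proof -
  have "finite \<B>" "\<B> \<noteq> {}"
    using matroid_on_finite(1)[OF assms] assms by (auto simp: matroid_on_def)
  then obtain A where "A \<in> \<B>" "\<And>A'. A' \<in> \<B> \<Longrightarrow> f A + sum u A \<le> f A' + sum u A'"
    using finite_ex_min[of \<B> "\<lambda>A. f A + sum u A"] by blast
  then show ?thesis by (auto simp: min_bases_def)
qed

lemma tilted_weight_sum: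
  assumes "\<forall>i\<in>{1..k}. matroid_on E (M i)" "B \<in> base_configuration k M"
  shows "tilted_weight E k (\<lambda>B. \<Sum>i\<in>{1..k}. \<mu> i (B i)) u B = (\<Sum>i\<in>{1..k}. \<mu> i (B i) + sum u (B i))"
proof -
  have "(\<Sum>x\<in>E. u x * (\<Sum>i\<in>{1..k}. indicator (B i) x)) = (\<Sum>i\<in>{1..k}. \<Sum>x\<in>E. u x * indicator (B i) x)"
    by (subst sum.swap) (simp add: sum_distrib_left)
  also have "\<dots> = (\<Sum>i\<in>{1..k}. sum u (B i))"
  proof (rule sum.cong[OF refl])
    fix i assume i: "i \<in> {1..k}"
    then have "matroid_on E (M i)" "B i \<in> M i"
      using assms by (auto simp: base_configuration_def PiE_iff)
    then have "finite E" "B i \<subseteq> E" unfolding matroid_on_def by blast+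
    then show "(\<Sum>x\<in>E. u x * indicator (B i) x) = sum u (B i)"
      by (simp add: sum.inter_restrict[symmetric] indicator_def if_distrib Int_absorb1
          cong: if_cong)
  qed
  finally show ?thesis by (simp add: tilted_weight_def sum.distrib)
qed

text \<open>Varying one entry of \<open>B\<close> at a time shows that every factor is minimal on
  its own; conversely, factorwise minimality adds up.\<close>

lemma subdivision_cell_sum:
  assumes m: "\<forall>i\<in>{1..k}. matroid_on E (M i)"
  shows "subdivision_cell E k M (\<lambda>B. \<Sum>i\<in>{1..k}. \<mu> i (B i)) u =
         base_configuration k (\<lambda>i. min_bases (M i) (\<mu> i) u)"
proof (intro set_eqI iffI)
  let ?c = "\<lambda>i A. \<mu> i A + sum u A"
  fix B assume "B \<in> subdivision_cell E k M (\<lambda>B. \<Sum>i\<in>{1..k}. \<mu> i (B i)) u"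
  then have B: "B \<in> base_configuration k M"
    and min: "\<And>B'. B' \<in> base_configuration k M \<Longrightarrow>
      (\<Sum>i\<in>{1..k}. ?c i (B i)) \<le> (\<Sum>i\<in>{1..k}. ?c i (B' i))"
    using tilted_weight_sum[OF m] by (auto simp: subdivision_cell_def)
  have "?c i (B i) \<le> ?c i A" if i: "i \<in> {1..k}" and A: "A \<in> M i" for i A
  proof -
    have "B(i := A) \<in> base_configuration k M"
      using B i A by (auto simp: base_configuration_def PiE_iff extensional_def)
    note le = min[OF this]
    have "(\<Sum>j\<in>{1..k} - {i}. ?c j ((B(i := A)) j)) = (\<Sum>j\<in>{1..k} - {i}. ?c j (B j))"
      by (intro sum.cong) auto
    then show ?thesis
      using le unfolding sum.remove[OF finite_atLeastAtMost i] fun_upd_same by linarith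
  qed
  then show "B \<in> base_configuration k (\<lambda>i. min_bases (M i) (\<mu> i) u)"
    using B by (auto simp: base_configuration_def PiE_iff min_bases_def)
next
  fix B assume B: "B \<in> base_configuration k (\<lambda>i. min_bases (M i) (\<mu> i) u)"
  then have BM: "B \<in> base_configuration k M"
    by (auto simp: base_configuration_def PiE_iff min_bases_def)
  show "B \<in> subdivision_cell E k M (\<lambda>B. \<Sum>i\<in>{1..k}. \<mu> i (B i)) u"
    unfolding subdivision_cell_def
  proof (intro CollectI conjI BM ballI)
    fix B' assume B': "B' \<in> base_configuration k M"
    show "tilted_weight E k (\<lambda>B. \<Sum>i\<in>{1..k}. \<mu> i (B i)) u B \<le>
      tilted_weight E k (\<lambda>B. \<Sum>i\<in>{1..k}. \<mu> i (B i)) u B'"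
      unfolding tilted_weight_sum[OF m BM] tilted_weight_sum[OF m B']
      using B B' by (intro sum_mono) (auto simp: base_configuration_def PiE_iff min_bases_def)
  qed
qed

text \<open>A priori only the product of the cells is the product of some flag matroid. Products of
  nonempty factors determine their factors, so the cells themselves are that flag matroid.\<close>

lemma flag_matroid_min_bases:
  assumes m: "\<forall>i\<in>{1..k}. matroid_on E (M i)"
    and fl: "flag_matroidal E k (coherent_subdivision E k M (\<lambda>B. \<Sum>i\<in>{1..k}. \<mu> i (B i)))"
  shows "flag_matroid E k (\<lambda>i. min_bases (M i) (\<mu> i) u)"
proof -
  have "base_configuration k (\<lambda>i. min_bases (M i) (\<mu> i) u) \<in>
      coherent_subdivision E k M (\<lambda>B. \<Sum>i\<in>{1..k}. \<mu> i (B i))"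
    unfolding subdivision_cell_sum[OF m, symmetric] coherent_subdivision_def by blast
  then obtain N where N: "flag_matroid E k N"
    "base_configuration k (\<lambda>i. min_bases (M i) (\<mu> i) u) = base_configuration k N"
    using fl unfolding flag_matroidal_def by blast
  have "N i \<noteq> {}" if "i \<in> {1..k}" for i
    using N(1) that by (auto simp: flag_matroid_def matroid_on_def)
  then have "min_bases (M i) (\<mu> i) u = N i" if "i \<in> {1..k}" for i
    using N(2) m min_bases_nonempty that unfolding base_configuration_def
    by (subst (asm) PiE_eq_iff_not_empty) blast+
  then show ?thesis using N(1) by (simp add: flag_matroid_def)
qed

subsection \<open>Restriction and contraction of a valuated matroid\<close>

lemma max_bases_card:
  assumes "A \<in> max_bases \<B> S" "B \<in> max_bases \<B> S"
  shows "card (A \<inter> S) = card (B \<inter> S)"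
  using assms by (simp add: max_bases_def le_antisym)

lemma max_bases_nonempty:
  assumes "matroid_on E \<B>"
  shows "max_bases \<B> S \<noteq> {}"
proof -
  have "finite \<B>" "\<B> \<noteq> {}"
    using matroid_on_finite(1)[OF assms] assms by (auto simp: matroid_on_def)
  then obtain A where "A \<in> \<B>" "\<And>A'. A' \<in> \<B> \<Longrightarrow> - real (card (A \<inter> S)) \<le> - real (card (A' \<inter> S))"
    using finite_ex_min[of \<B> "\<lambda>A. - real (card (A \<inter> S))"] by blast
  then show ?thesis by (auto simp: max_bases_def)
qed

text \<open>\<open>of_bool\<close> on both sides keeps the count free of truncated
  subtraction.\<close>

lemma card_Int_exchange:
  assumes "finite A" "i \<in> A" "j \<notin> A"
  shows "card (insert j (A - {i}) \<inter> S) + of_bool (i \<in> S) = card (A \<inter> S) + of_bool (j \<in> S)"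
proof -
  have "card (A \<inter> S - {i}) + of_bool (i \<in> S) = card (A \<inter> S)"
    using assms card.remove[of "A \<inter> S" i] by auto
  moreover have "insert j (A - {i}) \<inter> S = (if j \<in> S then insert j (A \<inter> S - {i}) else A \<inter> S - {i})"
    by auto
  ultimately show ?thesis using assms by simp
qed

text \<open>If \<open>i\<close> and \<open>j\<close> lay on different sides of \<open>S\<close>, one
  of the two exchanged bases would meet \<open>S\<close> in more elements than the maximum.\<close>

lemma max_bases_exchange:
  assumes m: "matroid_on E \<B>" and ve: "valuated_exchange \<B> f"
    and A: "A \<in> max_bases \<B> S" and B: "B \<in> max_bases \<B> S" and i: "i \<in> A - B"
  obtains j where "j \<in> B - A" "j \<in> S \<longleftrightarrow> i \<in> S"
    "insert j (A - {i}) \<in> max_bases \<B> S" "insert i (B - {j}) \<in> max_bases \<B> S"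
    "f (insert j (A - {i})) + f (insert i (B - {j})) \<le> f A + f B"
proof -
  have AB: "A \<in> \<B>" "B \<in> \<B>" using A B by (auto simp: max_bases_def)
  then have "exchangeable \<B> f A B i" using ve i unfolding valuated_exchange_def by blast
  then obtain j where j: "j \<in> B - A" "insert j (A - {i}) \<in> \<B>" "insert i (B - {j}) \<in> \<B>"
    "f (insert j (A - {i})) + f (insert i (B - {j})) \<le> f A + f B"
    unfolding exchangeable_def by blast
  have cA: "card (insert j (A - {i}) \<inter> S) + of_bool (i \<in> S) = card (A \<inter> S) + of_bool (j \<in> S)"
    and cB: "card (insert i (B - {j}) \<inter> S) + of_bool (j \<in> S) = card (B \<inter> S) + of_bool (i \<in> S)"
    using card_Int_exchange[of A i j] card_Int_exchange[of B j i] matroid_on_finite(2)[OF m] AB i j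
    by auto
  have "card (insert j (A - {i}) \<inter> S) \<le> card (A \<inter> S)" "card (insert i (B - {j}) \<inter> S) \<le> card (B \<inter> S)"
    using A B j by (auto simp: max_bases_def)
  then have ij: "j \<in> S \<longleftrightarrow> i \<in> S" using cA cB by (auto split: if_splits simp: of_bool_def)
  then have "card (insert j (A - {i}) \<inter> S) = card (A \<inter> S)" "card (insert i (B - {j}) \<inter> S) = card (B \<inter> S)"
    using cA cB by auto
  then have "insert j (A - {i}) \<in> max_bases \<B> S" "insert i (B - {j}) \<in> max_bases \<B> S"
    using A B j by (auto simp: max_bases_def)
  then show ?thesis using that j ij by blast
qed

lemma max_bases_Int_eq:
  assumes "matroid_on E \<B>" "A \<in> max_bases \<B> S" "B \<in> max_bases \<B> S" "A \<inter> S \<subseteq> B"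
  shows "A \<inter> S = B \<inter> S"
proof (rule card_subset_eq)
  show "finite (B \<inter> S)" using assms matroid_on_finite(2)[OF assms(1)] by (auto simp: max_bases_def)
qed (use assms max_bases_card in auto)

lemma max_bases_Diff_eq:
  assumes m: "matroid_on E \<B>" and A: "A \<in> max_bases \<B> S" and B: "B \<in> max_bases \<B> S"
    and sub: "A - S \<subseteq> B"
  shows "A - S = B - S"
proof (rule card_subset_eq)
  have AB: "A \<in> \<B>" "B \<in> \<B>" using A B by (auto simp: max_bases_def)
  have fin: "finite A" "finite B" using matroid_on_finite(2)[OF m] AB by auto
  then show "finite (B - S)" by simp
  show "card (A - S) = card (B - S)"
    using matroid_card_eq[OF m AB] max_bases_card[OF A B] fin
    by (simp add: card_Diff_subset_Int)
qed (use sub in auto)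

text \<open>Same-side exchanges at elements of \<open>S\<close> alter \<open>B\<close> only inside
  \<open>S\<close>, so they can replace \<open>B \<inter> S\<close> by \<open>A \<inter> S\<close>.
  Thus \<open>max_bases\<close> is a product of its parts inside and outside
  \<open>S\<close>.\<close>

lemma max_bases_product:
  assumes m: "matroid_on E \<B>" and ve: "valuated_exchange \<B> f"
    and A: "A \<in> max_bases \<B> S" and B: "B \<in> max_bases \<B> S"
  shows "(A \<inter> S) \<union> (B - S) \<in> max_bases \<B> S"
  using B
proof (induction "card (A \<inter> S - B)" arbitrary: B rule: less_induct)
  case less
  show ?case
  proof (cases "A \<inter> S \<subseteq> B")
    case True
    then have "(A \<inter> S) \<union> (B - S) = B" using max_bases_Int_eq[OF m A less.prems] by blast
    then show ?thesis using less.prems by simp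
  next
    case False
    then obtain i where i: "i \<in> A - B" "i \<in> S" by blast
    obtain j where j: "j \<in> B - A" "j \<in> S \<longleftrightarrow> i \<in> S" "insert i (B - {j}) \<in> max_bases \<B> S"
      using max_bases_exchange[OF m ve A less.prems i(1)] .
    have "finite A" using A matroid_on_finite(2)[OF m] by (auto simp: max_bases_def)
    then have "card (A \<inter> S - insert i (B - {j})) < card (A \<inter> S - B)"
      using i j by (intro psubset_card_mono) auto
    from less.hyps[OF this j(3)]
    have "(A \<inter> S) \<union> (insert i (B - {j}) - S) \<in> max_bases \<B> S" .
    moreover have "insert i (B - {j}) - S = B - S" using i j by auto
    ultimately show ?thesis by simp
  qed
qed

text \<open>The part of \<open>A\<close> outside \<open>S\<close> is moved towards \<open>B\<close>
  one swap at a time. Each move spans a square of four bases, and exchange along its two diagonals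
  gives opposite inequalities. So the cost of a swap inside \<open>S\<close> does not depend on what
  lies outside.\<close>

lemma max_bases_split_neighbour:
  assumes m: "matroid_on E \<B>" and ve: "valuated_exchange \<B> f"
    and "A \<in> max_bases \<B> S" "insert j (A - {i}) \<in> max_bases \<B> S"
    and ij: "i \<in> S" "j \<in> S" "i \<in> A" "j \<notin> A" and B: "B \<in> max_bases \<B> S"
  shows "f A + f ((insert j (A - {i}) \<inter> S) \<union> (B - S)) = f (insert j (A - {i})) + f ((A \<inter> S) \<union> (B - S))"
  using assms(3,4) ij
proof (induction "card (A - S - B)" arbitrary: A rule: less_induct)
  case less
  note A = less.prems(1) and A2 = less.prems(2)
  let ?A2 = "insert j (A - {i})"
  show ?case
  proof (cases "A - S \<subseteq> B")
    case True
    then have "A - S = B - S" using max_bases_Diff_eq[OF m A B] by blast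
    moreover from this have "?A2 - S = B - S" using less.prems by auto
    ultimately have "(?A2 \<inter> S) \<union> (B - S) = ?A2" "(A \<inter> S) \<union> (B - S) = A" by blast+
    then show ?thesis by simp
  next
    case False
    then obtain k where k: "k \<in> A" "k \<notin> S" "k \<notin> B" by blast
    \<comment> \<open>This basis agrees with \<open>A\<close> on \<open>S\<close>, so exchange
      against it replaces \<open>k\<close> by an element of \<open>B\<close> outside
      \<open>S\<close>.\<close>
    have P: "(A \<inter> S) \<union> (B - S) \<in> max_bases \<B> S" using max_bases_product[OF m ve A B] .
    obtain l where l: "l \<in> (A \<inter> S) \<union> (B - S) - A" "l \<in> S \<longleftrightarrow> k \<in> S"
      and A': "insert l (A - {k}) \<in> max_bases \<B> S"
      using max_bases_exchange[OF m ve A P, of k] k by blast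
    have l': "l \<in> B" "l \<notin> S" "l \<notin> A" using l k by auto
    let ?A' = "insert l (A - {k})" and ?A2' = "insert j (insert l (A - {k}) - {i})"
    have "?A2' = (?A2 \<inter> S) \<union> (?A' - S)" using k l' less.prems by auto
    then have A2': "?A2' \<in> max_bases \<B> S" using max_bases_product[OF m ve A2 A'] by simp
    \<comment> \<open>The candidates here are \<open>j\<close> and \<open>l\<close>, and only
      \<open>j\<close> lies in \<open>S\<close> like \<open>i\<close>. In \<open>down\<close> the
      same argument leaves only \<open>i\<close>.\<close>
    have up: "f ?A2 + f ?A' \<le> f A + f ?A2'"
    proof -
      obtain q where q: "q \<in> ?A2' - A" "q \<in> S \<longleftrightarrow> i \<in> S"
        "f (insert q (A - {i})) + f (insert i (?A2' - {q})) \<le> f A + f ?A2'"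
        by (rule max_bases_exchange[OF m ve A A2', of i]) (use less.prems l' k in auto)
      then have "q = j" using less.prems l' by auto
      moreover have "insert i (?A2' - {j}) = ?A'" using less.prems l' k by auto
      ultimately show ?thesis using q(3) by simp
    qed
    have down: "f A + f ?A2' \<le> f ?A2 + f ?A'"
    proof -
      obtain q where q: "q \<in> ?A' - ?A2" "q \<in> S \<longleftrightarrow> j \<in> S"
        "f (insert q (?A2 - {j})) + f (insert j (?A' - {q})) \<le> f ?A2 + f ?A'"
        by (rule max_bases_exchange[OF m ve A2 A', of j]) (use less.prems l' k in auto)
      then have "q = i" using less.prems l' by auto
      moreover have "insert i (?A2 - {j}) = A" using less.prems l' k by auto
      ultimately show ?thesis using q(3) by simp
    qed
    have finA: "finite (A - S - B)"
      using A matroid_on_finite(2)[OF m] by (auto simp: max_bases_def)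
    have "?A' - S - B \<subseteq> A - S - B - {k}" using l' by blast
    then have "card (?A' - S - B) \<le> card (A - S - B - {k})" using finA by (intro card_mono) auto
    also have "\<dots> < card (A - S - B)" using finA k by (intro card_Diff1_less) auto
    finally have "f ?A' + f ((?A2' \<inter> S) \<union> (B - S)) = f ?A2' + f ((?A' \<inter> S) \<union> (B - S))"
      by (rule less.hyps[OF _ A' A2']) (use less.prems l' k in auto)
    moreover have "?A2' \<inter> S = ?A2 \<inter> S" "?A' \<inter> S = A \<inter> S" using l' k by auto
    ultimately show ?thesis using up down by simp
  qed
qed

text \<open>Telescoping: swaps inside \<open>S\<close> move \<open>A\<close> towards
  \<open>B\<close>, and each changes both sides equally. This four-term identity separates
  \<open>f\<close> into a restriction and a contraction.\<close>

lemma max_bases_split: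
  assumes m: "matroid_on E \<B>" and ve: "valuated_exchange \<B> f"
    and A: "A \<in> max_bases \<B> S" and B: "B \<in> max_bases \<B> S"
  shows "f A + f B = f ((A \<inter> S) \<union> (B - S)) + f ((B \<inter> S) \<union> (A - S))"
  using A
proof (induction "card (A \<inter> S - B)" arbitrary: A rule: less_induct)
  case less
  note A = less.prems
  show ?case
  proof (cases "A \<inter> S \<subseteq> B")
    case True
    then have "A \<inter> S = B \<inter> S" using max_bases_Int_eq[OF m A B] by blast
    then have "(A \<inter> S) \<union> (B - S) = B" "(B \<inter> S) \<union> (A - S) = A" by blast+
    then show ?thesis by simp
  next
    case False
    then obtain i where i: "i \<in> A - B" "i \<in> S" by blast
    obtain j where j: "j \<in> B - A" "j \<in> S \<longleftrightarrow> i \<in> S" and A1: "insert j (A - {i}) \<in> max_bases \<B> S"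
      using max_bases_exchange[OF m ve A B i(1)] .
    let ?A1 = "insert j (A - {i})"
    have "f A + f ((?A1 \<inter> S) \<union> (B - S)) = f ?A1 + f ((A \<inter> S) \<union> (B - S))"
      using max_bases_split_neighbour[OF m ve A A1 _ _ _ _ B] i j by blast
    moreover have "finite A" using A matroid_on_finite(2)[OF m] by (auto simp: max_bases_def)
    then have "card (?A1 \<inter> S - B) < card (A \<inter> S - B)"
      using i j by (intro psubset_card_mono) auto
    from less.hyps[OF this A1]
    have "f ?A1 + f B = f ((?A1 \<inter> S) \<union> (B - S)) + f ((B \<inter> S) \<union> (?A1 - S))" .
    moreover have "?A1 - S = A - S" using i j by auto
    ultimately show ?thesis by simp
  qed
qed

text \<open>Applied to \<open>T = S\<close> and \<open>T = - S\<close>, this gives the restriction and the contraction.\<close>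

lemma valuated_exchange_side:
  assumes "finite E" "P \<subseteq> Pow E" and B0: "B0 \<in> P"
    and exch: "\<And>A B i. A \<in> P \<Longrightarrow> B \<in> P \<Longrightarrow> i \<in> A - B \<Longrightarrow>
      \<exists>j\<in>B - A. (j \<in> T \<longleftrightarrow> i \<in> T) \<and> insert j (A - {i}) \<in> P \<and> insert i (B - {j}) \<in> P \<and>
        f (insert j (A - {i})) + f (insert i (B - {j})) \<le> f A + f B"
    and prod: "\<And>A B. A \<in> P \<Longrightarrow> B \<in> P \<Longrightarrow> (A \<inter> T) \<union> (B - T) \<in> P"
  shows "matroid_on (E \<inter> T) ((\<lambda>A. A \<inter> T) ` P)" (is ?mat)
    and "valuated_exchange ((\<lambda>A. A \<inter> T) ` P) (\<lambda>I. f (I \<union> (B0 - T)) - c)" (is ?ve)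
proof -
  show ve: ?ve
    unfolding valuated_exchange_def
  proof (intro ballI)
    fix I I' i assume "I \<in> (\<lambda>A. A \<inter> T) ` P" "I' \<in> (\<lambda>A. A \<inter> T) ` P" and i: "i \<in> I - I'"
    then obtain A B where AB: "A \<in> P" "B \<in> P" and I: "I = A \<inter> T" "I' = B \<inter> T" by blast
    \<comment> \<open>Both sets are completed by the same elements of \<open>B0\<close> outside
      \<open>T\<close>. The completions differ only inside \<open>T\<close>, and exchange in
      \<open>P\<close> stays on that side.\<close>
    let ?A = "I \<union> (B0 - T)" and ?B = "I' \<union> (B0 - T)"
    have P: "?A \<in> P" "?B \<in> P" using prod AB B0 I by auto
    have "i \<in> ?A - ?B" "i \<in> T" using i I by auto
    then obtain j where j: "j \<in> ?B - ?A" "j \<in> T" and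
      ex: "insert j (?A - {i}) \<in> P" "insert i (?B - {j}) \<in> P"
        "f (insert j (?A - {i})) + f (insert i (?B - {j})) \<le> f ?A + f ?B"
      using exch[OF P] by blast
    have eq: "insert j (?A - {i}) = insert j (I - {i}) \<union> (B0 - T)"
      "insert i (?B - {j}) = insert i (I' - {j}) \<union> (B0 - T)"
      using j \<open>i \<in> T\<close> by auto
    have "insert j (I - {i}) = insert j (?A - {i}) \<inter> T" "insert i (I' - {j}) = insert i (?B - {j}) \<inter> T"
      using j \<open>i \<in> T\<close> I by auto
    then have "insert j (I - {i}) \<in> (\<lambda>A. A \<inter> T) ` P" "insert i (I' - {j}) \<in> (\<lambda>A. A \<inter> T) ` P"
      using ex(1,2) by blast+
    moreover have "j \<in> I' - I" using j by auto
    ultimately show "exchangeable ((\<lambda>A. A \<inter> T) ` P) (\<lambda>I. f (I \<union> (B0 - T)) - c) I I' i"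
      unfolding exchangeable_def using ex(3) by (intro bexI[of _ j]) (auto simp: eq)
  qed
  show ?mat
    unfolding matroid_on_def
  proof (intro conjI ballI)
    fix I I' i assume "I \<in> (\<lambda>A. A \<inter> T) ` P" "I' \<in> (\<lambda>A. A \<inter> T) ` P" "i \<in> I - I'"
    then show "\<exists>j\<in>I' - I. insert j (I - {i}) \<in> (\<lambda>A. A \<inter> T) ` P"
      using ve unfolding valuated_exchange_def exchangeable_def by meson
  qed (use assms(1,2) B0 in auto)
qed

text \<open>\<open>valuated_contraction\<close> is a choice, so existence is what makes its defining
  properties available.\<close>

lemma restriction_contraction_pair_exists:
  assumes m: "matroid_on E \<B>" and ve: "valuated_exchange \<B> f" and S: "S \<subseteq> E"
  shows "\<exists>\<nu> \<rho>. restriction_contraction_pair E (matroid_rank \<B>) (extend_by_infinity \<B> f) S \<rho> \<nu>"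
proof -
  let ?P = "max_bases \<B> S"
  obtain B0 where B0: "B0 \<in> ?P" using max_bases_nonempty[OF m] by blast
  have fin: "finite E" and P: "?P \<subseteq> Pow E"
    using m by (auto simp: matroid_on_def max_bases_def)
  have exS: "\<exists>j\<in>B - A. (j \<in> S \<longleftrightarrow> i \<in> S) \<and> insert j (A - {i}) \<in> ?P \<and> insert i (B - {j}) \<in> ?P \<and>
        f (insert j (A - {i})) + f (insert i (B - {j})) \<le> f A + f B"
    if "A \<in> ?P" "B \<in> ?P" "i \<in> A - B" for A B i
    by (rule max_bases_exchange[OF m ve that]) blast
  then have exC: "\<exists>j\<in>B - A. (j \<in> - S \<longleftrightarrow> i \<in> - S) \<and> insert j (A - {i}) \<in> ?P \<and> insert i (B - {j}) \<in> ?P \<and>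
        f (insert j (A - {i})) + f (insert i (B - {j})) \<le> f A + f B"
    if "A \<in> ?P" "B \<in> ?P" "i \<in> A - B" for A B i
    using that by simp
  have prC: "(A \<inter> - S) \<union> (B - - S) \<in> ?P" if "A \<in> ?P" "B \<in> ?P" for A B
    using max_bases_product[OF m ve that(2,1)] by (simp add: Diff_eq Un_commute)
  note prS = max_bases_product[OF m ve]
  note sideS = valuated_exchange_side(1)[OF fin P B0 exS prS]
    valuated_exchange_side(2)[OF fin P B0 exS prS, of 0]
  note sideC = valuated_exchange_side(1)[OF fin P B0 exC prC]
    valuated_exchange_side(2)[OF fin P B0 exC prC, of "f B0"]
  define \<R> where "\<R> = matroid_restriction \<B> S"
  define \<C> where "\<C> = matroid_contraction \<B> S"
  \<comment> \<open>Both parts are read off from completions by the fixed basis \<open>B0\<close>.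
    The extra \<open>f B0\<close> in the splitting identity is subtracted once, on the contraction
    side.\<close>
  define r where "r I = f (I \<union> (B0 - S))" for I
  define c where "c J = f (J \<union> (B0 \<inter> S)) - f B0" for J
  have R: "matroid_on S \<R>" "valuated_exchange \<R> r"
    using sideS S by (simp_all add: \<R>_def matroid_restriction_def r_def[abs_def] Int_absorb1)
  have C: "matroid_on (E - S) \<C>" "valuated_exchange \<C> c"
    using sideC by (simp_all add: \<C>_def matroid_contraction_def c_def[abs_def] Diff_eq)
  have "extend_by_infinity \<B> f B = extend_by_infinity \<R> r (B \<inter> S) + extend_by_infinity \<C> c (B - S)"
    if B: "B \<in> ?P" for B
  proof -
    have "B \<in> \<B>" "B \<inter> S \<in> \<R>" "B - S \<in> \<C>"
      using B by (auto simp: \<R>_def \<C>_def matroid_restriction_def matroid_contraction_def max_bases_def)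
    moreover have "f B = r (B \<inter> S) + c (B - S)"
      using max_bases_split[OF m ve B B0] by (simp add: r_def c_def Un_commute)
    ultimately show ?thesis by (simp add: extend_by_infinity_def)
  qed
  then have "restriction_contraction_pair E (matroid_rank \<B>) (extend_by_infinity \<B> f) S
      (extend_by_infinity \<R> r) (extend_by_infinity \<C> c)"
    unfolding restriction_contraction_pair_def Let_def vbases_extend_by_infinity[OF m]
      \<R>_def[symmetric] \<C>_def[symmetric]
    using valuated_matroid_extend_by_infinity[OF R] valuated_matroid_extend_by_infinity[OF C]
      vbases_extend_by_infinity[OF R(1)] vbases_extend_by_infinity[OF C(1)] by simp
  then show ?thesis by blast
qed

subsection \<open>Tropical linear spaces and loopless cells\<close>

lemma sum_exchange:
  fixes u :: "'a \<Rightarrow> real"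
  assumes "finite A" "i \<in> A" "j \<notin> A"
  shows "sum u (insert j (A - {i})) = sum u A - u i + u j"
  using assms by (simp add: sum.remove[of A i])

text \<open>Since no value is \<open>-\<infinity>\<close>, a finite right-hand side of the exchange
  inequality forces both exchanged sets to be bases, and all four values are real.\<close>

lemma valuated_matroid_real:
  assumes vm: "valuated_matroid F r \<nu>" and g: "g = (\<lambda>J. real_of_ereal (\<nu> J))"
  shows "J \<in> vbases F r \<nu> \<Longrightarrow> \<nu> J = ereal (g J)"
    and "valuated_exchange (vbases F r \<nu>) g"
proof -
  have fin: "\<nu> J = ereal (g J)" if "J \<in> vbases F r \<nu>" for J
  proof -
    have "\<nu> J \<noteq> \<infinity>" "\<nu> J \<noteq> - \<infinity>" using vm that by (auto simp: valuated_matroid_def vbases_def)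
    then show ?thesis by (cases "\<nu> J") (simp_all add: g)
  qed
  then show "J \<in> vbases F r \<nu> \<Longrightarrow> \<nu> J = ereal (g J)" .
  have finF: "finite F" using vm by (simp add: valuated_matroid_def matroid_on_def)
  show "valuated_exchange (vbases F r \<nu>) g"
    unfolding valuated_exchange_def
  proof (intro ballI)
    fix A B i assume A: "A \<in> vbases F r \<nu>" and B: "B \<in> vbases F r \<nu>" and i: "i \<in> A - B"
    then obtain j where j: "j \<in> B - A"
      and le: "\<nu> (insert j (A - {i})) + \<nu> (insert i (B - {j})) \<le> \<nu> A + \<nu> B"
      using vm unfolding valuated_matroid_def by blast
    let ?A = "insert j (A - {i})" and ?B = "insert i (B - {j})"
    have sub: "A \<subseteq> F" "B \<subseteq> F" "card A = r" "card B = r"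
      using A B by (auto simp: vbases_def subsets_of_card_def)
    then have "finite A" "finite B" using finF finite_subset by blast+
    then have mem: "?A \<in> subsets_of_card F r" "?B \<in> subsets_of_card F r"
      using card_exchange[of A i j] card_exchange[of B j i] i j sub
      by (auto simp: subsets_of_card_def)
    have "\<nu> ?A \<noteq> - \<infinity>" "\<nu> ?B \<noteq> - \<infinity>" using vm mem by (auto simp: valuated_matroid_def)
    moreover have "\<nu> A + \<nu> B < \<infinity>" using fin[OF A] fin[OF B] by simp
    ultimately have "\<nu> ?A \<noteq> \<infinity>" "\<nu> ?B \<noteq> \<infinity>" using le by auto
    then have AB: "?A \<in> vbases F r \<nu>" "?B \<in> vbases F r \<nu>" using mem by (auto simp: vbases_def)
    then show "exchangeable (vbases F r \<nu>) g A B i"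
      unfolding exchangeable_def using j le fin[OF A] fin[OF B] fin[OF AB(1)] fin[OF AB(2)]
      by (intro bexI[of _ j]) auto
  qed
qed

text \<open>For a minimizer \<open>B\<close> missing \<open>x\<close>, the circuit of
  \<open>T = insert x B\<close> has the value of \<open>B\<close> at \<open>x\<close> and the values
  of the swaps of \<open>x\<close> into \<open>B\<close> elsewhere. Up to the constant
  \<open>sum u T\<close>, adding \<open>u l\<close> at \<open>l\<close> amounts to subtracting the
  sum of \<open>u\<close> over \<open>T - {l}\<close>, hence the tilt by \<open>- u\<close>. A
  minimal coordinate other than \<open>x\<close> gives a minimizer through \<open>x\<close>.\<close>

lemma loopless_of_min_attained_twice:
  assumes vm: "valuated_matroid F r \<nu>" and g: "g = (\<lambda>J. real_of_ereal (\<nu> J))"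
    and twice: "\<forall>C\<in>valuated_circuits F r \<nu>. min_attained_twice F C u" and x: "x \<in> F"
  shows "\<exists>J\<in>min_bases (vbases F r \<nu>) g (\<lambda>x. - u x). x \<in> J"
proof -
  let ?C = "vbases F r \<nu>"
  have m: "matroid_on F ?C" using vm by (simp add: valuated_matroid_def)
  obtain B where B: "B \<in> min_bases ?C g (\<lambda>x. - u x)" using min_bases_nonempty[OF m] by blast
  show ?thesis
  proof (cases "x \<in> B")
    case False
    have BC: "B \<in> ?C" using B by (simp add: min_bases_def)
    have finB: "finite B" using matroid_on_finite(2)[OF m BC] .
    have sub: "B \<subseteq> F" "card B = r" using BC by (auto simp: vbases_def subsets_of_card_def)
    define T where "T = insert x B"
    have T: "T \<in> subsets_of_card F (r + 1)"
      using x sub False finB by (simp add: subsets_of_card_def T_def)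
    have Tx: "T - {x} = B" using False by (auto simp: T_def)
    have cx: "circuit_vector \<nu> T x = ereal (g B)"
      using valuated_matroid_real(1)[OF vm g BC] Tx by (simp add: circuit_vector_def T_def)
    then have cx': "circuit_vector \<nu> T x \<noteq> \<infinity>" by simp
    then have "circuit_vector \<nu> T \<noteq> (\<lambda>_. \<infinity>)" by metis
    then have "min_attained_twice F (circuit_vector \<nu> T) u"
      using twice T by (auto simp: valuated_circuits_def)
    then obtain l where l: "l \<noteq> x" "circuit_vector \<nu> T l \<noteq> \<infinity>"
      "circuit_vector \<nu> T l + ereal (u l) \<le> circuit_vector \<nu> T x + ereal (u x)"
      unfolding min_attained_twice_def using x cx' by metis
    have lT: "l \<in> T" using l(2) by (auto simp: circuit_vector_def split: if_splits)
    then have cl: "circuit_vector \<nu> T l = \<nu> (T - {l})" by (simp add: circuit_vector_def)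
    have D: "T - {l} \<in> ?C"
      using l(2) T lT unfolding cl by (auto simp: vbases_def subsets_of_card_def)
    have Tl: "T - {l} = insert x (B - {l})" using l(1) by (auto simp: T_def)
    have "l \<in> B" using lT l(1) by (simp add: T_def)
    then have "sum (\<lambda>x. - u x) (T - {l}) = sum (\<lambda>x. - u x) B + u l - u x"
      using sum_exchange[OF finB _ False, of l "\<lambda>x. - u x"] Tl by simp
    moreover have "g (T - {l}) + u l \<le> g B + u x"
      using l(3) unfolding cl cx valuated_matroid_real(1)[OF vm g D] by simp
    ultimately have "g (T - {l}) + sum (\<lambda>x. - u x) (T - {l}) \<le> g B + sum (\<lambda>x. - u x) B"
      by linarith
    then have "T - {l} \<in> min_bases ?C g (\<lambda>x. - u x)"
      using B D unfolding min_bases_def by force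
    moreover have "x \<in> T - {l}" using l(1) by (simp add: T_def)
    ultimately show ?thesis by (rule bexI[rotated])
  next
    case True
    then show ?thesis using B by (rule bexI)
  qed
qed

text \<open>Take a minimal coordinate \<open>x\<close> of the circuit of \<open>T\<close> and a
  minimizer \<open>B\<close> through \<open>x\<close>. Exchanging \<open>x\<close> between
  \<open>B\<close> and \<open>T - {x}\<close> brings some \<open>j\<close> into \<open>B\<close>;
  minimality of \<open>B\<close> then makes the coordinate at \<open>j\<close> no larger than that
  at \<open>x\<close>.\<close>

lemma min_attained_twice_of_loopless:
  assumes vm: "valuated_matroid F r \<nu>" and g: "g = (\<lambda>J. real_of_ereal (\<nu> J))"
    and loopless: "\<forall>x\<in>F. \<exists>J\<in>min_bases (vbases F r \<nu>) g (\<lambda>x. - u x). x \<in> J"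
    and C: "C \<in> valuated_circuits F r \<nu>"
  shows "min_attained_twice F C u"
proof -
  let ?C = "vbases F r \<nu>"
  have m: "matroid_on F ?C" using vm by (simp add: valuated_matroid_def)
  have finF: "finite F" using m by (simp add: matroid_on_def)
  note val = valuated_matroid_real[OF vm g]
  obtain T where T: "T \<in> subsets_of_card F (r + 1)" and C_eq: "C = circuit_vector \<nu> T"
    and ne: "C \<noteq> (\<lambda>_. \<infinity>)" using C by (auto simp: valuated_circuits_def)
  have TF: "T \<subseteq> F" and cT: "card T = r + 1" using T by (auto simp: subsets_of_card_def)
  have finT: "finite T" using TF finF finite_subset by blast
  have Cfin: "C l \<noteq> \<infinity> \<longleftrightarrow> l \<in> T \<and> T - {l} \<in> ?C" for l
    using TF cT by (auto simp: C_eq circuit_vector_def vbases_def subsets_of_card_def)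
  have Cval: "C l = ereal (g (T - {l}))" if "C l \<noteq> \<infinity>" for l
    using that val(1)[of "T - {l}"] Cfin[of l] by (simp add: C_eq circuit_vector_def)
  let ?L = "{l. C l \<noteq> \<infinity>}"
  have L: "finite ?L" using Cfin finT by (auto intro: finite_subset[of _ T])
  have L': "?L \<noteq> {}" using ne by auto
  obtain x where xL: "x \<in> ?L" and "\<And>l. l \<in> ?L \<Longrightarrow> g (T - {x}) + u x \<le> g (T - {l}) + u l"
    using finite_ex_min[OF L L', of "\<lambda>l. g (T - {l}) + u l"] by metis
  then have min: "g (T - {x}) + u x \<le> g (T - {l}) + u l" if "C l \<noteq> \<infinity>" for l
    using that by simp
  have x: "C x \<noteq> \<infinity>" using xL by simp
  have xT: "x \<in> T" and TC: "T - {x} \<in> ?C" using x Cfin by auto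
  obtain B where B: "B \<in> min_bases ?C g (\<lambda>x. - u x)" and xB: "x \<in> B"
    using loopless xT TF by blast
  have BC: "B \<in> ?C" using B by (simp add: min_bases_def)
  have finB: "finite B" using matroid_on_finite(2)[OF m BC] .
  have "exchangeable ?C g B (T - {x}) x"
    using val(2) BC TC xB unfolding valuated_exchange_def by blast
  then obtain j where j: "j \<in> T - {x} - B" and ex: "insert j (B - {x}) \<in> ?C"
     "insert x (T - {x} - {j}) \<in> ?C"
     "g (insert j (B - {x})) + g (insert x (T - {x} - {j})) \<le> g B + g (T - {x})"
    unfolding exchangeable_def by blast
  have Tj: "insert x (T - {x} - {j}) = T - {j}" using xT j by auto
  have jfin: "C j \<noteq> \<infinity>" using j ex(2) Tj Cfin by auto
  have "g B + sum (\<lambda>x. - u x) B \<le> g (insert j (B - {x})) + sum (\<lambda>x. - u x) (insert j (B - {x}))"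
    using B ex(1) by (simp add: min_bases_def)
  moreover have "sum (\<lambda>x. - u x) (insert j (B - {x})) = sum (\<lambda>x. - u x) B + u x - u j"
    using sum_exchange[OF finB xB, of j "\<lambda>x. - u x"] j by simp
  ultimately have jx: "g (T - {j}) + u j \<le> g (T - {x}) + u x" using ex(3) Tj by simp
  have le: "C x + ereal (u x) \<le> C l + ereal (u l) \<and> C j + ereal (u j) \<le> C l + ereal (u l)"
    if l: "C l \<noteq> \<infinity>" for l
    using min[OF l] jx Cval[OF l] Cval[OF x] Cval[OF jfin] by simp
  have "x \<in> F" "j \<in> F" "x \<noteq> j" using xT j TF by auto
  then show ?thesis
    unfolding min_attained_twice_def
    by (intro bexI[where x = x, OF bexI[where x = j]]) (use le x jfin in simp_all)
qed

lemma min_attained_twice_shift: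
  assumes "\<And>i. i \<in> F \<Longrightarrow> v i = u i + c" "min_attained_twice F C u"
  shows "min_attained_twice F C v"
proof -
  have shift: "C a + ereal (v a) \<le> C b + ereal (v b)"
    if "a \<in> F" "b \<in> F" "C a + ereal (u a) \<le> C b + ereal (u b)" for a b
  proof -
    have "C a + ereal (u a) + ereal c \<le> C b + ereal (u b) + ereal c"
      using that(3) by (rule add_right_mono)
    then show ?thesis using assms(1) that(1,2) by (simp add: add.assoc)
  qed
  then show ?thesis using assms(2) unfolding min_attained_twice_def by blast
qed

text \<open>Membership provides only some representative \<open>v\<close> of the class; adding a
  constant to it does not affect the condition.\<close>

lemma torus_class_in_trop_iff:
  assumes u: "u \<in> F \<rightarrow>\<^sub>E UNIV"
  shows "torus_rel F `` {u} \<in> trop F r \<nu> \<longleftrightarrow>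
         (\<forall>C\<in>valuated_circuits F r \<nu>. min_attained_twice F C u)"
proof
  assume "torus_rel F `` {u} \<in> trop F r \<nu>"
  then obtain v where v: "v \<in> F \<rightarrow>\<^sub>E UNIV" "torus_rel F `` {u} = torus_rel F `` {v}"
    and tw: "\<forall>C\<in>valuated_circuits F r \<nu>. min_attained_twice F C v"
    unfolding trop_def by blast
  have "(u, u) \<in> torus_rel F" using u by (auto simp: torus_rel_def intro: exI[of _ 0])
  then have "(v, u) \<in> torus_rel F" using v(2) by blast
  then obtain c where "\<forall>i\<in>F. u i = v i + c" by (auto simp: torus_rel_def)
  then show "\<forall>C\<in>valuated_circuits F r \<nu>. min_attained_twice F C u"
    using tw min_attained_twice_shift[of F u v c] by blast
next
  assume "\<forall>C\<in>valuated_circuits F r \<nu>. min_attained_twice F C u"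
  then show "torus_rel F `` {u} \<in> trop F r \<nu>" using u unfolding trop_def by blast
qed

text \<open>Tilting by \<open>- t\<close> on \<open>S\<close> for large \<open>t\<close> selects the bases of maximal intersection with \<open>S\<close>.\<close>

definition contraction_tilt :: "'a set \<Rightarrow> real \<Rightarrow> ('a \<Rightarrow> real) \<Rightarrow> 'a \<Rightarrow> real" where
  "contraction_tilt S t u x = (if x \<in> S then - t else - u x)"

lemma sum_contraction_tilt:
  assumes "finite A"
  shows "sum (contraction_tilt S t u) A = sum (\<lambda>x. - u x) (A - S) - t * card (A \<inter> S)"
proof -
  have "sum (contraction_tilt S t u) A =
      sum (contraction_tilt S t u) (A \<inter> S) + sum (contraction_tilt S t u) (A - S)"
    using sum.Int_Diff[OF assms] .
  also have "sum (contraction_tilt S t u) (A \<inter> S) = - t * card (A \<inter> S)"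
    by (simp add: contraction_tilt_def)
  also have "sum (contraction_tilt S t u) (A - S) = sum (\<lambda>x. - u x) (A - S)"
    by (intro sum.cong) (auto simp: contraction_tilt_def)
  finally show ?thesis by simp
qed

text \<open>A bound valid for all larger \<open>t\<close> allows one \<open>t\<close> to serve two
  matroids at once.\<close>

lemma min_bases_contraction_tilt_subset:
  assumes m: "matroid_on E \<B>"
  shows "\<exists>t0. \<forall>t\<ge>t0. min_bases \<B> f (contraction_tilt S t u) \<subseteq> max_bases \<B> S"
proof -
  obtain t0 where t0: "\<And>(t::real) A B. t \<ge> t0 \<Longrightarrow> A \<in> \<B> \<Longrightarrow> B \<in> \<B> \<Longrightarrow> card (A \<inter> S) < card (B \<inter> S) \<Longrightarrow>
      f B + sum (\<lambda>x. - u x) (B - S) - t * card (B \<inter> S) < f A + sum (\<lambda>x. - u x) (A - S) - t * card (A \<inter> S)"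
    using large_penalty[OF matroid_on_finite(1)[OF m], of "\<lambda>A. int (card (A \<inter> S))"
        "\<lambda>A. f A + sum (\<lambda>x. - u x) (A - S)"] by auto
  have "A \<in> max_bases \<B> S" if "t \<ge> t0" and A: "A \<in> min_bases \<B> f (contraction_tilt S t u)" for t A
  proof -
    have AB: "A \<in> \<B>" using A by (simp add: min_bases_def)
    have "card (B \<inter> S) \<le> card (A \<inter> S)" if B: "B \<in> \<B>" for B
    proof (rule ccontr)
      assume "\<not> card (B \<inter> S) \<le> card (A \<inter> S)"
      then have "f B + sum (contraction_tilt S t u) B < f A + sum (contraction_tilt S t u) A"
        using t0[OF \<open>t \<ge> t0\<close> AB B] matroid_on_finite(2)[OF m] AB B by (simp add: sum_contraction_tilt)
      then show False using A B by (force simp: min_bases_def)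
    qed
    then show ?thesis using AB by (simp add: max_bases_def)
  qed
  then show ?thesis by blast
qed

text \<open>On \<open>max_bases\<close> the term \<open>t * card (A \<inter> S)\<close> is constant,
  and the remaining cost splits into a part inside \<open>S\<close> and the cost of the contraction
  outside. As \<open>max_bases\<close> is a product, the two parts are minimized
  independently.\<close>

lemma min_bases_contraction_iff:
  assumes m: "matroid_on E \<B>" and ve: "valuated_exchange \<B> f"
    and pair: "restriction_contraction_pair E (matroid_rank \<B>) (extend_by_infinity \<B> f) S \<rho> \<nu>"
    and g: "g = (\<lambda>J. real_of_ereal (\<nu> J))"
    and sub: "min_bases \<B> f (contraction_tilt S t u) \<subseteq> max_bases \<B> S" and x: "x \<notin> S"
  shows "(\<exists>A\<in>min_bases \<B> f (contraction_tilt S t u). x \<in> A) \<longleftrightarrow>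
         (\<exists>J\<in>min_bases (matroid_contraction \<B> S) g (\<lambda>x. - u x). x \<in> J)"
proof -
  let ?P = "max_bases \<B> S" and ?C = "matroid_contraction \<B> S" and ?R = "matroid_restriction \<B> S"
  let ?t = "contraction_tilt S t u" and ?u = "\<lambda>x. - u x"
  note p = pair[unfolded restriction_contraction_pair_def Let_def vbases_extend_by_infinity[OF m]]
  define h where "h = (\<lambda>I. real_of_ereal (\<rho> I))"
  have split: "f A = h (A \<inter> S) + g (A - S)" if A: "A \<in> ?P" for A
  proof -
    have "\<rho> (A \<inter> S) = ereal (h (A \<inter> S))" "\<nu> (A - S) = ereal (g (A - S))"
      using valuated_matroid_real(1)[of S _ \<rho> h] valuated_matroid_real(1)[of "E - S" _ \<nu> g] p A
      by (auto simp: h_def g matroid_restriction_def matroid_contraction_def)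
    moreover have "A \<in> \<B>" using A by (simp add: max_bases_def)
    moreover have "extend_by_infinity \<B> f A = \<rho> (A \<inter> S) + \<nu> (A - S)" using p A by blast
    ultimately show ?thesis by (simp add: extend_by_infinity_def)
  qed
  have cost: "f A + sum ?t A = h (A \<inter> S) - t * card (A \<inter> S) + (g (A - S) + sum ?u (A - S))"
    if A: "A \<in> ?P" for A
    using split[OF A] sum_contraction_tilt[of A S t u] matroid_on_finite(2)[OF m, of A] A
    by (simp add: max_bases_def)
  have mix: "(A \<inter> S) \<union> J \<in> ?P" "((A \<inter> S) \<union> J) \<inter> S = A \<inter> S" "((A \<inter> S) \<union> J) - S = J"
    if "A \<in> ?P" "J \<in> ?C" for A J
    using that max_bases_product[OF m ve that(1)] by (auto simp: matroid_contraction_def)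
  have PB: "A \<in> \<B>" if "A \<in> ?P" for A using that by (simp add: max_bases_def)
  show ?thesis
  proof
    assume "\<exists>A\<in>min_bases \<B> f ?t. x \<in> A"
    then obtain A where A: "A \<in> min_bases \<B> f ?t" "x \<in> A" by blast
    have AP: "A \<in> ?P" using A sub by blast
    have "g (A - S) + sum ?u (A - S) \<le> g J + sum ?u J" if J: "J \<in> ?C" for J
    proof -
      have "f A + sum ?t A \<le> f ((A \<inter> S) \<union> J) + sum ?t ((A \<inter> S) \<union> J)"
        using A PB[OF mix(1)[OF AP J]] by (simp add: min_bases_def)
      then show ?thesis
        unfolding cost[OF AP] cost[OF mix(1)[OF AP J]] mix(2,3)[OF AP J] by simp
    qed
    moreover have "A - S \<in> ?C" using AP by (auto simp: matroid_contraction_def)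
    ultimately show "\<exists>J\<in>min_bases ?C g ?u. x \<in> J"
      using A x by (intro bexI[of _ "A - S"]) (auto simp: min_bases_def)
  next
    assume "\<exists>J\<in>min_bases ?C g ?u. x \<in> J"
    then obtain J where J: "J \<in> min_bases ?C g ?u" "x \<in> J" by blast
    then have JC: "J \<in> ?C" by (simp add: min_bases_def)
    obtain A where A: "A \<in> min_bases \<B> f ?t" using min_bases_nonempty[OF m] by blast
    have AP: "A \<in> ?P" using A sub by blast
    have "A - S \<in> ?C" using AP by (auto simp: matroid_contraction_def)
    then have "g J + sum ?u J \<le> g (A - S) + sum ?u (A - S)" using J by (simp add: min_bases_def)
    then have "f ((A \<inter> S) \<union> J) + sum ?t ((A \<inter> S) \<union> J) \<le> f A + sum ?t A"
      unfolding cost[OF AP] cost[OF mix(1)[OF AP JC]] mix(2,3)[OF AP JC] by simp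
    then have "(A \<inter> S) \<union> J \<in> min_bases \<B> f ?t"
      using A PB[OF mix(1)[OF AP JC]] unfolding min_bases_def by force
    then show "\<exists>A\<in>min_bases \<B> f ?t. x \<in> A" using J(2) by blast
  qed
qed

text \<open>The flag condition speaks of cells on the full ground set, hence this passage from the
  contraction to a cell on \<open>E\<close>.\<close>

lemma torus_class_in_trop_contraction_iff:
  assumes m: "matroid_on E \<B>" and ve: "valuated_exchange \<B> f" and S: "S \<subseteq> E"
    and u: "u \<in> E - S \<rightarrow>\<^sub>E UNIV"
    and sub: "min_bases \<B> f (contraction_tilt S t u) \<subseteq> max_bases \<B> S"
  defines "r \<equiv> matroid_rank \<B>" and "\<mu> \<equiv> extend_by_infinity \<B> f"
  shows "torus_rel (E - S) `` {u} \<in> trop (E - S) (contraction_rank E r \<mu> S) (valuated_contraction E r \<mu> S)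
    \<longleftrightarrow> (\<forall>x\<in>E - S. \<exists>A\<in>min_bases \<B> f (contraction_tilt S t u). x \<in> A)"
proof -
  define \<nu> where "\<nu> = valuated_contraction E r \<mu> S"
  define g where "g = (\<lambda>J. real_of_ereal (\<nu> J))"
  let ?C = "matroid_contraction \<B> S"
  obtain \<rho> where pair: "restriction_contraction_pair E r \<mu> S \<rho> \<nu>"
    using someI_ex[OF restriction_contraction_pair_exists[OF m ve S]]
    unfolding \<nu>_def valuated_contraction_def r_def \<mu>_def by blast
  have cr: "contraction_rank E r \<mu> S = matroid_rank ?C"
    by (simp add: contraction_rank_def r_def \<mu>_def vbases_extend_by_infinity[OF m])
  have vm: "valuated_matroid (E - S) (matroid_rank ?C) \<nu>"
    and vb: "vbases (E - S) (matroid_rank ?C) \<nu> = ?C"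
    using pair unfolding restriction_contraction_pair_def Let_def r_def \<mu>_def
      vbases_extend_by_infinity[OF m] by auto
  have "(\<forall>C\<in>valuated_circuits (E - S) (matroid_rank ?C) \<nu>. min_attained_twice (E - S) C u) \<longleftrightarrow>
      (\<forall>x\<in>E - S. \<exists>J\<in>min_bases ?C g (\<lambda>x. - u x). x \<in> J)"
    using loopless_of_min_attained_twice[OF vm g_def] min_attained_twice_of_loopless[OF vm g_def]
    unfolding vb by blast
  also have "\<dots> \<longleftrightarrow> (\<forall>x\<in>E - S. \<exists>A\<in>min_bases \<B> f (contraction_tilt S t u). x \<in> A)"
    using min_bases_contraction_iff[OF m ve pair[unfolded r_def \<mu>_def] g_def sub] by simp
  finally show ?thesis
    unfolding cr \<nu>_def[symmetric] torus_class_in_trop_iff[OF u] .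
qed

section \<open>Loops along a flag and the inclusion of tropical linear spaces\<close>

lemma loopless_quotient:
  assumes m: "matroid_on E N'"
    and quot: "\<forall>C\<in>matroid_circuits E N'. \<exists>\<D>. \<D> \<subseteq> matroid_circuits E N \<and> C = \<Union>\<D>"
    and x: "x \<in> E" "A \<in> N" "x \<in> A"
  shows "\<exists>A\<in>N'. x \<in> A"
proof (rule ccontr)
  assume loop: "\<not> (\<exists>A\<in>N'. x \<in> A)"
  \<comment> \<open>Nonemptiness makes the empty set independent, so the dependent singleton is a
    circuit.\<close>
  have "N' \<noteq> {}" using m by (simp add: matroid_on_def)
  then have "matroid_indep N' D" if "D \<subset> {x}" for D
    using that by (auto simp: matroid_indep_def subset_singleton_iff psubset_eq)
  then have "{x} \<in> matroid_circuits E N'"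
    using x loop by (auto simp: matroid_circuits_def matroid_indep_def)
  then obtain \<D> where D: "\<D> \<subseteq> matroid_circuits E N" "{x} = \<Union>\<D>" using quot by blast
  \<comment> \<open>A circuit inside \<open>{x}\<close> that contains \<open>x\<close> is
    \<open>{x}\<close> itself, so \<open>x\<close> is a loop of \<open>N\<close> too, contrary to
    \<open>x \<in> A\<close>.\<close>
  then obtain D where "D \<in> \<D>" "x \<in> D" by blast
  then have "D = {x}" "\<not> matroid_indep N D" using D by (auto simp: matroid_circuits_def)
  then show False using x by (auto simp: matroid_indep_def)
qed

theorem theorem4p20:
  fixes n k :: nat
    and M :: "nat \<Rightarrow> nat set set"
    and w :: "(nat \<Rightarrow> nat set) \<Rightarrow> real"
    and \<mu> :: "nat \<Rightarrow> nat set \<Rightarrow> real"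
  assumes "flag_matroid {1..n} k M"
    and "flag_matroidal {1..n} k (coherent_subdivision {1..n} k M w)"
    and "coherent_subdivision {1..n} k M w =
         coherent_subdivision {1..n} k M (\<lambda>B. \<Sum>i\<in>{1..k}. \<mu> i (B i))"
  shows "(\<forall>i\<in>{1..k}.
            valuated_matroid {1..n} (matroid_rank (M i)) (extend_by_infinity (M i) (\<mu> i))) \<and>
         (\<forall>i\<in>{1..<k}.
            proj_trop {1..n} (matroid_rank (M i)) (extend_by_infinity (M i) (\<mu> i)) \<subseteq>
            proj_trop {1..n} (matroid_rank (M (i + 1))) (extend_by_infinity (M (i + 1)) (\<mu> (i + 1))))"
proof -
  let ?E = "{1..n}"
  let ?N = "\<lambda>i u. min_bases (M i) (\<mu> i) u"
  have m: "\<forall>i\<in>{1..k}. matroid_on ?E (M i)" using assms(1) by (simp add: flag_matroid_def)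
  \<comment> \<open>Both weights have the same set of cells, so flag-matroidality passes from
    \<open>w\<close> to the sum.\<close>
  have flag: "flag_matroid ?E k (\<lambda>i. ?N i u)" for u
    using flag_matroid_min_bases[OF m, of \<mu> u] assms(2,3) by simp
  have cell: "matroid_on ?E (?N i u)" if "i \<in> {1..k}" for i u
    using flag[of u] that by (simp add: flag_matroid_def)
  have ve: "valuated_exchange (M i) (\<mu> i)" if i: "i \<in> {1..k}" for i
    using valuated_exchange_of_cells[of ?E "M i" "\<mu> i"] m cell[OF i] i by blast
  have "proj_trop ?E (matroid_rank (M i)) (extend_by_infinity (M i) (\<mu> i)) \<subseteq>
        proj_trop ?E (matroid_rank (M (i + 1))) (extend_by_infinity (M (i + 1)) (\<mu> (i + 1)))"
    if "i \<in> {1..<k}" for i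
  proof -
    have i: "i \<in> {1..k}" "i + 1 \<in> {1..k}" using that by auto
    have mi: "matroid_on ?E (M i)" "matroid_on ?E (M (i + 1))" using m i by blast+
    let ?T = "\<lambda>i S. trop (?E - S)
      (contraction_rank ?E (matroid_rank (M i)) (extend_by_infinity (M i) (\<mu> i)) S)
      (valuated_contraction ?E (matroid_rank (M i)) (extend_by_infinity (M i) (\<mu> i)) S)"
    \<comment> \<open>The inclusion holds stratum by stratum: the set \<open>S\<close> of infinite
      coordinates and the representative \<open>u\<close> are kept.\<close>
    have step: "torus_rel (?E - S) `` {u} \<in> ?T (i + 1) S"
      if S: "S \<subset> ?E" and u: "u \<in> ?E - S \<rightarrow>\<^sub>E UNIV" and mem: "torus_rel (?E - S) `` {u} \<in> ?T i S" for S u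
    proof -
      obtain t1 where t1: "\<And>t. t \<ge> t1 \<Longrightarrow> ?N i (contraction_tilt S t u) \<subseteq> max_bases (M i) S"
        using min_bases_contraction_tilt_subset[OF mi(1), of "\<mu> i" S u] by blast
      obtain t2 where t2: "\<And>t. t \<ge> t2 \<Longrightarrow> ?N (i + 1) (contraction_tilt S t u) \<subseteq> max_bases (M (i + 1)) S"
        using min_bases_contraction_tilt_subset[OF mi(2), of "\<mu> (i + 1)" S u] by blast
      \<comment> \<open>A common \<open>t\<close> puts both cells under the same tilt, as the flag
        condition requires.\<close>
      let ?t = "contraction_tilt S (max t1 t2) u"
      have SE: "S \<subseteq> ?E" using S by blast
      have "\<forall>x\<in>?E - S. \<exists>A\<in>?N i ?t. x \<in> A"
        using torus_class_in_trop_contraction_iff[OF mi(1) ve[OF i(1)] SE u t1[of "max t1 t2"]] mem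
        by simp
      moreover have "\<forall>C\<in>matroid_circuits ?E (?N (i + 1) ?t).
          \<exists>\<D>. \<D> \<subseteq> matroid_circuits ?E (?N i ?t) \<and> C = \<Union>\<D>"
        using flag[of ?t] i unfolding flag_matroid_def by (metis less_add_one)
      ultimately have "\<forall>x\<in>?E - S. \<exists>A\<in>?N (i + 1) ?t. x \<in> A"
        using loopless_quotient[OF cell[OF i(2)]] by (metis DiffD1)
      then show ?thesis
        using torus_class_in_trop_contraction_iff[OF mi(2) ve[OF i(2)] SE u t2[of "max t1 t2"]]
        by simp
    qed
    show ?thesis
    proof
      fix X assume "X \<in> proj_trop ?E (matroid_rank (M i)) (extend_by_infinity (M i) (\<mu> i))"
      then obtain S u where S: "S \<subset> ?E" and u: "u \<in> ?E - S \<rightarrow>\<^sub>E UNIV"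
        and X: "X = trop_proj_rel ?E `` {infinity_on ?E S u}" and mem: "torus_rel (?E - S) `` {u} \<in> ?T i S"
        unfolding proj_trop_def times_infinity_def by blast
      have "X \<in> times_infinity ?E S (?T (i + 1) S)"
        unfolding times_infinity_def using step[OF S u mem] u X by blast
      then show "X \<in> proj_trop ?E (matroid_rank (M (i + 1))) (extend_by_infinity (M (i + 1)) (\<mu> (i + 1)))"
        unfolding proj_trop_def using S by blast
    qed
  qed
  moreover have "valuated_matroid ?E (matroid_rank (M i)) (extend_by_infinity (M i) (\<mu> i))"
    if "i \<in> {1..k}" for i
    using valuated_matroid_extend_by_infinity m ve[OF that] that by blast
  ultimately show ?thesis by blast
qed

end
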